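(* For every $k \in \omega$ with $k \geq 2$, the following statements are equivalent over $\mathsf{RCA}_0$: (i) $\mathsf{RWKL}$; (ii) $\mathsf{LRWKL}$; (iii) $\mathsf{RWKL}_k$; (iv) $\mathsf{LRWKL}_k$.
   Context: $\mathsf{RCA}_0$ is the subsystem of second-order arithmetic axiomatized by the basic axioms of arithmetic, $\Sigma^0_1$ induction and $\Delta^0_1$ comprehension. $\mathbb{N}$ denotes the first-order part of a possibly nonstandard model, and $\omega$ denotes the standard natural numbers (so $k$ is a fixed standard number). Each $k$ is identified with $\{0,\dots,k-1\}$, and $k^{<\mathbb{N}}$ is the set of finite strings over $k$. A tree is a set of finite strings closed under initial segments. A set $H \subseteq \mathbb{N}$ is homogeneous for a string $\sigma \in k^{<\mathbb{N}}$ if $(\exists c < k)(\forall i \in H)(i < |\sigma| \rightarrow \sigma(i) = c)$. A set $H \subseteq \mathbb{N}$ is homogeneous for an infinite tree $T \subseteq k^{<\mathbb{N}}$ if the tree $\{\sigma \in T : H \text{ is homogeneous for } \sigma\}$ is infinite. $\mathsf{RWKL}_k$ is the statement "for every infinite tree $T \subseteq k^{<\mathbb{N}}$, there is an infinite $H \subseteq \mathbb{N}$ that is homogeneous for $T$." $\mathsf{LRWKL}_k$ is the statement "for every infinite tree $T \subseteq k^{<\mathbb{N}}$ and every infinite $X \subseteq \mathbb{N}$, there is an infinite $H \subseteq X$ that is homogeneous for $T$." $\mathsf{RWKL}$ and $\mathsf{LRWKL}$ are the corresponding statements for infinite trees $T \subseteq 2^{<\mathbb{N}}$ (i.e., the case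 $k = 2$). *)

theory Defs
  imports Main
begin

section \<open>Structures for the language of second-order arithmetic\<close>

text \<open>
  The number variables range over the type \<open>'a\<close>, whose elements form the (possibly nonstandard)
  first-order part of the structure; the set variables range over \<open>Sets\<close> (Henkin semantics).
\<close>

record 'a l2_structure =
  Zero :: 'a  ("\<zero>\<index>")
  One :: 'a  ("\<one>\<index>")
  Plus :: "'a \<Rightarrow> 'a \<Rightarrow> 'a"  (infixl "\<oplus>\<index>" 65)
  Times :: "'a \<Rightarrow> 'a \<Rightarrow> 'a"  (infixl "\<otimes>\<index>" 70)
  Less :: "'a \<Rightarrow> 'a \<Rightarrow> bool"  (infix "\<prec>\<index>" 50)
  Sets :: "'a set set"

datatype num_term =
    NVar nat
  | NZero
  | NOne
  | NPlus num_term num_term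
  | NTimes num_term num_term

text \<open>
  Bounded-quantifier formulas. Number variables are de Bruijn indices; set variables are never
  bound and serve as parameters. In \<open>BAll t \<theta>\<close>, which stands for
  \<open>(\<forall>x < t) \<theta>\<close>, the bound \<open>t\<close> lies outside the scope of the quantifier.
\<close>

datatype bounded_formula =
    EqF num_term num_term
  | LessF num_term num_term
  | MemF num_term nat
  | NegF bounded_formula
  | ConjF bounded_formula bounded_formula
  | BAll num_term bounded_formula

primrec term_val :: "'a l2_structure \<Rightarrow> (nat \<Rightarrow> 'a) \<Rightarrow> num_term \<Rightarrow> 'a" where
  "term_val M e (NVar i) = e i"
| "term_val M e NZero = \<zero>\<^bsub>M\<^esub>"
| "term_val M e NOne = \<one>\<^bsub>M\<^esub>"
| "term_val M e (NPlus s t) = term_val M e s \<oplus>\<^bsub>M\<^esub> term_val M e t"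
| "term_val M e (NTimes s t) = term_val M e s \<otimes>\<^bsub>M\<^esub> term_val M e t"

primrec sat :: "'a l2_structure \<Rightarrow> (nat \<Rightarrow> 'a set) \<Rightarrow> (nat \<Rightarrow> 'a) \<Rightarrow> bounded_formula \<Rightarrow> bool" where
  "sat M E e (EqF s t) \<longleftrightarrow> term_val M e s = term_val M e t"
| "sat M E e (LessF s t) \<longleftrightarrow> term_val M e s \<prec>\<^bsub>M\<^esub> term_val M e t"
| "sat M E e (MemF t X) \<longleftrightarrow> term_val M e t \<in> E X"
| "sat M E e (NegF \<phi>) \<longleftrightarrow> \<not> sat M E e \<phi>"
| "sat M E e (ConjF \<phi> \<psi>) \<longleftrightarrow> sat M E e \<phi> \<and> sat M E e \<psi>"
| "sat M E e (BAll t \<phi>) \<longleftrightarrow> (\<forall>x. x \<prec>\<^bsub>M\<^esub> term_val M e t \<longrightarrow> sat M E (case_nat x e) \<phi>)"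

text \<open>
  The formulas \<open>\<exists>m. \<theta>(m, n)\<close> and \<open>\<forall>m. \<theta>(m, n)\<close> with \<open>\<theta>\<close> bounded, as predicates
  of \<open>n\<close>: in \<open>\<theta>\<close>, variable 0 is \<open>m\<close>, variable 1 is \<open>n\<close>, and the
  remaining ones are number parameters.
\<close>

definition Sigma1 ::
  "'a l2_structure \<Rightarrow> (nat \<Rightarrow> 'a set) \<Rightarrow> (nat \<Rightarrow> 'a) \<Rightarrow> bounded_formula \<Rightarrow> 'a \<Rightarrow> bool" where
  "Sigma1 M E e \<theta> n \<longleftrightarrow> (\<exists>m. sat M E (case_nat m (case_nat n e)) \<theta>)"

definition Pi1 ::
  "'a l2_structure \<Rightarrow> (nat \<Rightarrow> 'a set) \<Rightarrow> (nat \<Rightarrow> 'a) \<Rightarrow> bounded_formula \<Rightarrow> 'a \<Rightarrow> bool" where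
  "Pi1 M E e \<theta> n \<longleftrightarrow> (\<forall>m. sat M E (case_nat m (case_nat n e)) \<theta>)"


section \<open>Models of \<open>RCA\<^sub>0\<close>\<close>

definition basic_axioms :: "'a l2_structure \<Rightarrow> bool" where
  "basic_axioms M \<longleftrightarrow>
     (\<forall>n. n \<oplus>\<^bsub>M\<^esub> \<one>\<^bsub>M\<^esub> \<noteq> \<zero>\<^bsub>M\<^esub>) \<and>
     (\<forall>m n. m \<oplus>\<^bsub>M\<^esub> \<one>\<^bsub>M\<^esub> = n \<oplus>\<^bsub>M\<^esub> \<one>\<^bsub>M\<^esub> \<longrightarrow> m = n) \<and>
     (\<forall>m. m \<oplus>\<^bsub>M\<^esub> \<zero>\<^bsub>M\<^esub> = m) \<and>
     (\<forall>m n. m \<oplus>\<^bsub>M\<^esub> (n \<oplus>\<^bsub>M\<^esub> \<one>\<^bsub>M\<^esub>) = (m \<oplus>\<^bsub>M\<^esub> n) \<oplus>\<^bsub>M\<^esub> \<one>\<^bsub>M\<^esub>) \<and>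
     (\<forall>m. m \<otimes>\<^bsub>M\<^esub> \<zero>\<^bsub>M\<^esub> = \<zero>\<^bsub>M\<^esub>) \<and>
     (\<forall>m n. m \<otimes>\<^bsub>M\<^esub> (n \<oplus>\<^bsub>M\<^esub> \<one>\<^bsub>M\<^esub>) = (m \<otimes>\<^bsub>M\<^esub> n) \<oplus>\<^bsub>M\<^esub> m) \<and>
     (\<forall>m. \<not> m \<prec>\<^bsub>M\<^esub> \<zero>\<^bsub>M\<^esub>) \<and>
     (\<forall>m n. m \<prec>\<^bsub>M\<^esub> n \<oplus>\<^bsub>M\<^esub> \<one>\<^bsub>M\<^esub> \<longleftrightarrow> m \<prec>\<^bsub>M\<^esub> n \<or> m = n)"

definition Sigma1_induction :: "'a l2_structure \<Rightarrow> bool" where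
  "Sigma1_induction M \<longleftrightarrow>
     (\<forall>\<theta> e E. range E \<subseteq> Sets M \<longrightarrow>
        Sigma1 M E e \<theta> \<zero>\<^bsub>M\<^esub> \<longrightarrow>
        (\<forall>n. Sigma1 M E e \<theta> n \<longrightarrow> Sigma1 M E e \<theta> (n \<oplus>\<^bsub>M\<^esub> \<one>\<^bsub>M\<^esub>)) \<longrightarrow>
        (\<forall>n. Sigma1 M E e \<theta> n))"

definition Delta1_comprehension :: "'a l2_structure \<Rightarrow> bool" where
  "Delta1_comprehension M \<longleftrightarrow>
     (\<forall>\<theta> \<psi> e E. range E \<subseteq> Sets M \<longrightarrow>
        (\<forall>n. Sigma1 M E e \<theta> n \<longleftrightarrow> Pi1 M E e \<psi> n) \<longrightarrow>
        {n. Sigma1 M E e \<theta> n} \<in> Sets M)"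

text \<open>
  Without \<open>Sets M \<noteq> {}\<close> the two schemes could hold vacuously, because \<open>E\<close> assigns
  a value to every set variable.
\<close>

definition RCA0_model :: "'a l2_structure \<Rightarrow> bool" where
  "RCA0_model M \<longleftrightarrow>
     Sets M \<noteq> {} \<and> basic_axioms M \<and> Sigma1_induction M \<and> Delta1_comprehension M"


section \<open>Finite strings inside a structure\<close>

primrec numeral_in :: "'a l2_structure \<Rightarrow> nat \<Rightarrow> 'a" where
  "numeral_in M 0 = \<zero>\<^bsub>M\<^esub>"
| "numeral_in M (Suc n) = numeral_in M n \<oplus>\<^bsub>M\<^esub> \<one>\<^bsub>M\<^esub>"

definition pair_in :: "'a l2_structure \<Rightarrow> 'a \<Rightarrow> 'a \<Rightarrow> 'a" where
  "pair_in M i j = (i \<oplus>\<^bsub>M\<^esub> j) \<otimes>\<^bsub>M\<^esub> (i \<oplus>\<^bsub>M\<^esub> j) \<oplus>\<^bsub>M\<^esub> i"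

text \<open>
  Goedel's beta function: \<open>c\<close> is the remainder of \<open>a\<close> modulo
  \<open>(i + 1) b + 1\<close>.
\<close>

definition beta_in :: "'a l2_structure \<Rightarrow> 'a \<Rightarrow> 'a \<Rightarrow> 'a \<Rightarrow> 'a \<Rightarrow> bool" where
  "beta_in M a b i c \<longleftrightarrow>
     (let d = (i \<oplus>\<^bsub>M\<^esub> \<one>\<^bsub>M\<^esub>) \<otimes>\<^bsub>M\<^esub> b \<oplus>\<^bsub>M\<^esub> \<one>\<^bsub>M\<^esub>
      in c \<prec>\<^bsub>M\<^esub> d \<and> (\<exists>q. a = q \<otimes>\<^bsub>M\<^esub> d \<oplus>\<^bsub>M\<^esub> c))"

text \<open>
  A number \<open>(n, (a, b))\<close> describes the string of length \<open>n\<close> whose entry at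
  \<open>i < n\<close> is given by the beta function. The least number describing a given
  string is its code, so that distinct codes are distinct strings.
  \<open>length_in M s n\<close> means \<open>|s| = n\<close>, and \<open>entry_in M s i c\<close> means
  \<open>i < |s|\<close> and \<open>s(i) = c\<close>.
\<close>

definition length_in :: "'a l2_structure \<Rightarrow> 'a \<Rightarrow> 'a \<Rightarrow> bool" where
  "length_in M s n \<longleftrightarrow> (\<exists>a b. s = pair_in M n (pair_in M a b))"

definition entry_in :: "'a l2_structure \<Rightarrow> 'a \<Rightarrow> 'a \<Rightarrow> 'a \<Rightarrow> bool" where
  "entry_in M s i c \<longleftrightarrow>
     (\<exists>n a b. s = pair_in M n (pair_in M a b) \<and> i \<prec>\<^bsub>M\<^esub> n \<and> beta_in M a b i c)"

definition same_string :: "'a l2_structure \<Rightarrow> 'a \<Rightarrow> 'a \<Rightarrow> bool" where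
  "same_string M s t \<longleftrightarrow>
     (\<exists>n. length_in M s n \<and> length_in M t n) \<and>
     (\<forall>i c. entry_in M s i c \<longleftrightarrow> entry_in M t i c)"

definition is_string :: "'a l2_structure \<Rightarrow> 'a \<Rightarrow> bool" where
  "is_string M s \<longleftrightarrow>
     (\<exists>n. length_in M s n) \<and> \<not> (\<exists>t. t \<prec>\<^bsub>M\<^esub> s \<and> same_string M t s)"

definition strings_over :: "'a l2_structure \<Rightarrow> nat \<Rightarrow> 'a set" where
  "strings_over M k =
     {s. is_string M s \<and> (\<forall>i c. entry_in M s i c \<longrightarrow> c \<prec>\<^bsub>M\<^esub> numeral_in M k)}"

definition initial_segment :: "'a l2_structure \<Rightarrow> 'a \<Rightarrow> 'a \<Rightarrow> bool" where
  "initial_segment M s t \<longleftrightarrow>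
     (\<exists>m n. length_in M s m \<and> length_in M t n \<and> (m \<prec>\<^bsub>M\<^esub> n \<or> m = n)) \<and>
     (\<forall>i c. entry_in M s i c \<longrightarrow> entry_in M t i c)"


section \<open>Trees, homogeneous sets and the Ramsey-type weak Koenig's lemmas\<close>

text \<open>Infinite in the sense of the structure, i.e. unbounded.\<close>

definition infinite_in :: "'a l2_structure \<Rightarrow> 'a set \<Rightarrow> bool" where
  "infinite_in M X \<longleftrightarrow> (\<forall>n. \<exists>x\<in>X. n \<prec>\<^bsub>M\<^esub> x)"

definition tree_in :: "'a l2_structure \<Rightarrow> nat \<Rightarrow> 'a set \<Rightarrow> bool" where
  "tree_in M k T \<longleftrightarrow>
     T \<in> Sets M \<and> T \<subseteq> strings_over M k \<and>
     (\<forall>t\<in>T. \<forall>s. is_string M s \<and> initial_segment M s t \<longrightarrow> s \<in> T)"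

definition homogeneous_string :: "'a l2_structure \<Rightarrow> nat \<Rightarrow> 'a set \<Rightarrow> 'a \<Rightarrow> bool" where
  "homogeneous_string M k H s \<longleftrightarrow>
     (\<exists>c. c \<prec>\<^bsub>M\<^esub> numeral_in M k \<and>
        (\<forall>i\<in>H. (\<exists>n. length_in M s n \<and> i \<prec>\<^bsub>M\<^esub> n) \<longrightarrow> entry_in M s i c))"

definition homogeneous_tree :: "'a l2_structure \<Rightarrow> nat \<Rightarrow> 'a set \<Rightarrow> 'a set \<Rightarrow> bool" where
  "homogeneous_tree M k H T \<longleftrightarrow> infinite_in M {s \<in> T. homogeneous_string M k H s}"

definition RWKL_k :: "'a l2_structure \<Rightarrow> nat \<Rightarrow> bool" where
  "RWKL_k M k \<longleftrightarrow>
     (\<forall>T. tree_in M k T \<and> infinite_in M T \<longrightarrow>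
        (\<exists>H\<in>Sets M. infinite_in M H \<and> homogeneous_tree M k H T))"

definition LRWKL_k :: "'a l2_structure \<Rightarrow> nat \<Rightarrow> bool" where
  "LRWKL_k M k \<longleftrightarrow>
     (\<forall>T. \<forall>X\<in>Sets M. tree_in M k T \<and> infinite_in M T \<and> infinite_in M X \<longrightarrow>
        (\<exists>H\<in>Sets M. H \<subseteq> X \<and> infinite_in M H \<and> homogeneous_tree M k H T))"

definition RWKL :: "'a l2_structure \<Rightarrow> bool" where
  "RWKL M \<longleftrightarrow> RWKL_k M 2"

definition LRWKL :: "'a l2_structure \<Rightarrow> bool" where
  "LRWKL M \<longleftrightarrow> LRWKL_k M 2"

end

theory Submission
  imports Defs
begin

text \<open>
  Everything is reduced to one construction. Let \<open>T\<close> be an infinite tree over \<open>k\<close> and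
  \<open>X\<close> an infinite set. For each \<open>i\<close> let \<open>f(i)\<close> be the least element of \<open>X\<close> that
  is at least \<open>i\<close>. A relation \<open>R\<close> that assigns to every colour occurring in \<open>T\<close> at a
  position in \<open>X\<close> some new colours below \<open>l\<close> yields the tree \<open>S\<close> of all strings
  \<open>\<sigma>\<close> over \<open>l\<close> for which some \<open>\<tau> \<in> T\<close> has \<open>R (\<tau>(f(i))) (\<sigma>(i))\<close>
  for all \<open>i < |\<sigma>|\<close>. If \<open>G\<close> is infinite and homogeneous for \<open>S\<close>, then
  \<open>H = f[G] \<subseteq> X\<close> is infinite, and infinitely many \<open>\<tau> \<in> T\<close> have a single new colour
  that is related to all their colours on \<open>H\<close> (lemma \<open>RWKL_recolour\<close>). The map \<open>f\<close>
  is preferred to the increasing enumeration of \<open>X\<close> because its graph is definable by a bounded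
  formula, whereas an enumeration calls for primitive recursion inside the model; and because
  \<open>i \<le> f(i)\<close>, the set \<open>H\<close> is definable by a bounded formula as well.
  
  With \<open>R\<close> the equality this shows that the Ramsey-type principle for \<open>l\<close> colours implies
  its localized form. To pass from \<open>k\<close> to \<open>k + 1\<close> colours, one first applies the principle
  for two colours with \<open>R\<close> distinguishing the colour \<open>k\<close> from all others. Either infinitely
  many strings have colour \<open>k\<close> on all of the resulting set, or infinitely many avoid \<open>k\<close>
  there; the latter form a tree to which the principle for \<open>k\<close> colours applies. Conversely, a
  tree over two colours is a tree over \<open>k\<close> colours, and a string over two colours that is
  homogeneous with a colour beyond these is homogeneous vacuously.
  
  What needs work in a nonstandard model is that \<open>S\<close> exists as a set and is infinite. It is
  \<open>\<Sigma>\<^sub>1\<close>-definable, and it becomes \<open>\<Delta>\<^sub>1\<close>-definable through a bound on the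
  codes of all strings of a given length over \<open>k\<close>. This bound comes from the Chinese remainder
  theorem: with a suitable modulus, any bounded definable finite sequence is the sequence of beta
  values of a number below a fixed common multiple of the moduli (lemma \<open>beta_solvable\<close>). The
  same bound shows that an infinite tree has strings of every length. All inductions and
  comprehensions are stated for predicates that have a bounded formula with parameters; closure
  properties of this class make these formulas implicit.
\<close>

section \<open>Predicates definable by bounded formulas\<close>

primrec rename_term :: "(nat \<Rightarrow> nat) \<Rightarrow> num_term \<Rightarrow> num_term" where
  "rename_term r (NVar i) = NVar (r i)"
| "rename_term r NZero = NZero"
| "rename_term r NOne = NOne"
| "rename_term r (NPlus s t) = NPlus (rename_term r s) (rename_term r t)"
| "rename_term r (NTimes s t) = NTimes (rename_term r s) (rename_term r t)"

primrec rename_formula ::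
  "(nat \<Rightarrow> nat) \<Rightarrow> (nat \<Rightarrow> nat) \<Rightarrow> bounded_formula \<Rightarrow> bounded_formula" where
  "rename_formula g r (EqF s t) = EqF (rename_term r s) (rename_term r t)"
| "rename_formula g r (LessF s t) = LessF (rename_term r s) (rename_term r t)"
| "rename_formula g r (MemF t X) = MemF (rename_term r t) (g X)"
| "rename_formula g r (NegF \<phi>) = NegF (rename_formula g r \<phi>)"
| "rename_formula g r (ConjF \<phi> \<psi>) = ConjF (rename_formula g r \<phi>) (rename_formula g r \<psi>)"
| "rename_formula g r (BAll t \<phi>) =
     BAll (rename_term r t) (rename_formula g (case_nat 0 (Suc \<circ> r)) \<phi>)"

lemma term_val_rename [simp]: "term_val M e (rename_term r t) = term_val M (e \<circ> r) t"
  by (induction t) auto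

lemma case_nat_comp_lift: "case_nat x e \<circ> case_nat 0 (Suc \<circ> r) = case_nat x (e \<circ> r)"
  by (auto simp: fun_eq_iff split: nat.split)

lemma sat_rename [simp]:
  "sat M E e (rename_formula g r \<phi>) \<longleftrightarrow> sat M (E \<circ> g) (e \<circ> r) \<phi>"
  by (induction \<phi> arbitrary: e r) (auto simp: case_nat_comp_lift)

text \<open>
  Even positions hold the arguments of a predicate and odd positions its number parameters. Two
  parameter lists, or two lists of set parameters, are combined in the same way, so that formulas
  with different parameters can be joined.
\<close>

definition interleave :: "(nat \<Rightarrow> 'b) \<Rightarrow> (nat \<Rightarrow> 'b) \<Rightarrow> nat \<Rightarrow> 'b" where
  "interleave f g i = (if even i then f (i div 2) else g (i div 2))"

lemma interleave_left: "f = interleave f g \<circ> (\<lambda>i. 2 * i)"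
  and interleave_right: "g = interleave f g \<circ> (\<lambda>i. 2 * i + 1)"
  by (auto simp: interleave_def)

definition term_over :: "'a l2_structure \<Rightarrow> (nat \<Rightarrow> 'a) \<Rightarrow> ((nat \<Rightarrow> 'a) \<Rightarrow> 'a) \<Rightarrow> bool" where
  "term_over M p t \<longleftrightarrow> (\<exists>s. \<forall>e. term_val M (interleave e p) s = t e)"

definition bounded_over ::
  "'a l2_structure \<Rightarrow> (nat \<Rightarrow> 'a set) \<Rightarrow> (nat \<Rightarrow> 'a) \<Rightarrow> ((nat \<Rightarrow> 'a) \<Rightarrow> bool) \<Rightarrow> bool" where
  "bounded_over M E p P \<longleftrightarrow> (\<exists>\<theta>. \<forall>e. sat M E (interleave e p) \<theta> \<longleftrightarrow> P e)"

text \<open>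
  Replacing the parameters by a sequence from which they can be selected only renames variables.
\<close>

lemma interleave_reparam:
  "interleave e (p \<circ> h) = interleave e p \<circ> (\<lambda>i. if even i then i else 2 * h (i div 2) + 1)"
  by (auto simp: interleave_def fun_eq_iff)

lemma term_over_reparam: "term_over M (p \<circ> h) t \<Longrightarrow> term_over M p t"
  unfolding term_over_def interleave_reparam term_val_rename[symmetric] by blast

lemma bounded_over_reparam: "bounded_over M (E \<circ> g) (p \<circ> h) P \<Longrightarrow> bounded_over M E p P"
  unfolding bounded_over_def interleave_reparam sat_rename[symmetric] by blast

locale rca0 =
  fixes M :: "'a l2_structure" (structure)
  assumes model: "RCA0_model M"
begin

definition definable_term :: "((nat \<Rightarrow> 'a) \<Rightarrow> 'a) \<Rightarrow> bool" where
  "definable_term t \<longleftrightarrow> (\<exists>p. term_over M p t)"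

text \<open>
  A predicate of environments is definable if, up to number and set parameters, a bounded formula
  expresses it. The notion is semantic: formulas and their variable bookkeeping disappear behind the
  closure rules below, which decompose a concrete predicate by its logical shape.
\<close>

definition definable :: "((nat \<Rightarrow> 'a) \<Rightarrow> bool) \<Rightarrow> bool" where
  "definable P \<longleftrightarrow> (\<exists>E p. range E \<subseteq> Sets M \<and> bounded_over M E p P)"

lemma definable_term_common:
  assumes "definable_term s" "definable_term t"
  obtains p where "term_over M p s" "term_over M p t"
proof -
  obtain p q where "term_over M p s" "term_over M q t"
    using assms by (auto simp: definable_term_def)
  then show ?thesis
    using that[of "interleave p q"]
    by (metis interleave_left interleave_right term_over_reparam)
qed

lemma definable_common_term:
  assumes "definable P" "definable_term t"
  obtains E p where "range E \<subseteq> Sets M" "bounded_over M E p P" "term_over M p t"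
proof -
  obtain E p q where *: "range E \<subseteq> Sets M" "bounded_over M E p P" "term_over M q t"
    using assms by (auto simp: definable_term_def definable_def)
  moreover have "bounded_over M E (interleave p q) P"
    by (rule bounded_over_reparam[of _ _ id _ "\<lambda>i. 2 * i"])
       (use *(2) in \<open>simp flip: interleave_left\<close>)
  moreover have "term_over M (interleave p q) t"
    using *(3) by (metis interleave_right term_over_reparam)
  ultimately show ?thesis
    using that by blast
qed

lemma definable_common:
  assumes "definable P" "definable Q"
  obtains E p where "range E \<subseteq> Sets M" "bounded_over M E p P" "bounded_over M E p Q"
proof -
  obtain E p F q where *: "range E \<subseteq> Sets M" "bounded_over M E p P"
      "range F \<subseteq> Sets M" "bounded_over M F q Q"
    using assms by (auto simp: definable_def)
  have "range (interleave E F) \<subseteq> Sets M"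
    using *(1,3) by (auto simp: interleave_def)
  moreover have "bounded_over M (interleave E F) (interleave p q) P"
    by (rule bounded_over_reparam[of _ _ "\<lambda>i. 2 * i" _ "\<lambda>i. 2 * i"])
       (use *(2) in \<open>simp flip: interleave_left\<close>)
  moreover have "bounded_over M (interleave E F) (interleave p q) Q"
    by (rule bounded_over_reparam[of _ _ "\<lambda>i. 2 * i + 1" _ "\<lambda>i. 2 * i + 1"])
       (use *(4) in \<open>simp only: flip: interleave_right\<close>)
  ultimately show ?thesis
    using that by blast
qed

lemma some_sets: obtains E :: "nat \<Rightarrow> 'a set" where "range E \<subseteq> Sets M"
proof -
  obtain A where "A \<in> Sets M"
    using model by (auto simp: RCA0_model_def)
  then show ?thesis
    using that[of "\<lambda>_. A"] by auto
qed

lemma definable_term_var: "definable_term (\<lambda>e. e i)"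
  unfolding definable_term_def term_over_def
  by (intro exI[of _ undefined] exI[of _ "NVar (2 * i)"]) (simp add: interleave_def)

lemma definable_term_const: "definable_term (\<lambda>e. a)"
  unfolding definable_term_def term_over_def
  by (intro exI[of _ "\<lambda>_. a"] exI[of _ "NVar 1"]) (simp add: interleave_def)

lemma definable_term_plus: assumes "definable_term s" "definable_term t" shows "definable_term (\<lambda>e. s e \<oplus> t e)"
proof -
  obtain p a b where "\<And>e. term_val M (interleave e p) a = s e" "\<And>e. term_val M (interleave e p) b = t e"
    using definable_term_common[OF assms] unfolding term_over_def by metis
  then show ?thesis
    unfolding definable_term_def term_over_def by (intro exI[of _ p] exI[of _ "NPlus a b"]) simp
qed

lemma definable_term_times: assumes "definable_term s" "definable_term t" shows "definable_term (\<lambda>e. s e \<otimes> t e)"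
proof -
  obtain p a b where "\<And>e. term_val M (interleave e p) a = s e" "\<And>e. term_val M (interleave e p) b = t e"
    using definable_term_common[OF assms] unfolding term_over_def by metis
  then show ?thesis
    unfolding definable_term_def term_over_def by (intro exI[of _ p] exI[of _ "NTimes a b"]) simp
qed

lemma interleave_rename:
  "interleave (\<lambda>i. e (r i)) p =
     interleave e p \<circ> (\<lambda>i. if even i then 2 * r (i div 2) else i)"
  by (auto simp: interleave_def fun_eq_iff)

lemma definable_term_shift: assumes "definable_term t" shows "definable_term (\<lambda>e. t (\<lambda>i. e (Suc i)))"
proof -
  obtain p s where s: "\<And>e. term_val M (interleave e p) s = t e"
    using assms unfolding definable_term_def term_over_def by metis
  have "term_val M (interleave e p)
      (rename_term (\<lambda>i. if even i then 2 * Suc (i div 2) else i) s) = t (\<lambda>i. e (Suc i))" for e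
    unfolding term_val_rename interleave_rename[of e Suc, symmetric] by (rule s)
  then show ?thesis
    unfolding definable_term_def term_over_def by (intro exI allI)
qed

lemma definable_rename: assumes "definable P" shows "definable (\<lambda>e. P (\<lambda>i. e (r i)))"
proof -
  obtain E p \<theta> where E: "range E \<subseteq> Sets M"
    and \<theta>: "\<And>e. sat M E (interleave e p) \<theta> \<longleftrightarrow> P e"
    using assms unfolding definable_def bounded_over_def by metis
  have "sat M E (interleave e p)
      (rename_formula id (\<lambda>i. if even i then 2 * r (i div 2) else i) \<theta>) \<longleftrightarrow>
    P (\<lambda>i. e (r i))" for e
    unfolding sat_rename comp_id interleave_rename[of e r, symmetric] by (rule \<theta>)
  then show ?thesis
    unfolding definable_def bounded_over_def using E by (intro exI conjI allI)
qed

lemma definable_eq: assumes "definable_term s" "definable_term t" shows "definable (\<lambda>e. s e = t e)"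
proof -
  obtain E :: "nat \<Rightarrow> 'a set" where "range E \<subseteq> Sets M" by (rule some_sets)
  moreover obtain p a b where
    "\<And>e. term_val M (interleave e p) a = s e" "\<And>e. term_val M (interleave e p) b = t e"
    using definable_term_common[OF assms] unfolding term_over_def by metis
  ultimately show ?thesis
    unfolding definable_def bounded_over_def
    by (intro exI[of _ E] exI[of _ p] exI[of _ "EqF a b"] conjI) auto
qed

lemma definable_less: assumes "definable_term s" "definable_term t" shows "definable (\<lambda>e. s e \<prec> t e)"
proof -
  obtain E :: "nat \<Rightarrow> 'a set" where "range E \<subseteq> Sets M" by (rule some_sets)
  moreover obtain p a b where
    "\<And>e. term_val M (interleave e p) a = s e" "\<And>e. term_val M (interleave e p) b = t e"
    using definable_term_common[OF assms] unfolding term_over_def by metis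
  ultimately show ?thesis
    unfolding definable_def bounded_over_def
    by (intro exI[of _ E] exI[of _ p] exI[of _ "LessF a b"] conjI) auto
qed

lemma definable_mem: assumes "X \<in> Sets M" "definable_term t" shows "definable (\<lambda>e. t e \<in> X)"
proof -
  obtain p a where "\<And>e. term_val M (interleave e p) a = t e"
    using assms(2) unfolding definable_term_def term_over_def by metis
  with assms(1) show ?thesis
    unfolding definable_def bounded_over_def
    by (intro exI[of _ "\<lambda>_. X"] exI[of _ p] exI[of _ "MemF a 0"] conjI) auto
qed

lemma definable_not: assumes "definable P" shows "definable (\<lambda>e. \<not> P e)"
proof -
  obtain E p \<theta> where "range E \<subseteq> Sets M" "\<And>e. sat M E (interleave e p) \<theta> \<longleftrightarrow> P e"
    using assms unfolding definable_def bounded_over_def by metis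
  then show ?thesis
    unfolding definable_def bounded_over_def
    by (intro exI[of _ E] exI[of _ p] exI[of _ "NegF \<theta>"] conjI) auto
qed

lemma definable_conj: assumes "definable P" "definable Q" shows "definable (\<lambda>e. P e \<and> Q e)"
proof -
  obtain E p a b where "range E \<subseteq> Sets M"
      "\<And>e. sat M E (interleave e p) a \<longleftrightarrow> P e" "\<And>e. sat M E (interleave e p) b \<longleftrightarrow> Q e"
    using definable_common[OF assms] unfolding bounded_over_def by metis
  then show ?thesis
    unfolding definable_def bounded_over_def
    by (intro exI[of _ E] exI[of _ p] exI[of _ "ConjF a b"] conjI) auto
qed

lemma definable_disj: assumes "definable P" "definable Q" shows "definable (\<lambda>e. P e \<or> Q e)"
proof -
  have "definable (\<lambda>e. \<not> (\<not> P e \<and> \<not> Q e))"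
    by (intro definable_not definable_conj assms)
  then show ?thesis by simp
qed

lemma definable_imp: assumes "definable P" "definable Q" shows "definable (\<lambda>e. P e \<longrightarrow> Q e)"
  unfolding imp_conv_disj by (intro definable_disj definable_not assms)

lemma definable_iff: assumes "definable P" "definable Q" shows "definable (\<lambda>e. P e \<longleftrightarrow> Q e)"
  unfolding iff_conv_conj_imp by (intro definable_conj definable_imp assms)

lemma interleave_case_nat:
  "interleave (case_nat x e) p =
     case_nat x (interleave e p) \<circ> (\<lambda>i. if i = 0 then 0 else if even i then i - 1 else i + 1)"
proof
  fix i :: nat
  show "interleave (case_nat x e) p i =
     (case_nat x (interleave e p) \<circ>
        (\<lambda>i. if i = 0 then 0 else if even i then i - 1 else i + 1)) i"
  proof (cases "even i")
    case True
    then obtain j where "i = 2 * j" by (auto elim: evenE)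
    then show ?thesis by (cases j) (auto simp: interleave_def)
  next
    case False
    then show ?thesis by (auto simp: interleave_def elim: oddE)
  qed
qed

text \<open>
  Under a quantifier the bound variable becomes variable 0 and the environment is shifted. The
  premise spells this out so that backward chaining through nested quantifiers ends in terms built
  from variables and constants.
\<close>

lemma definable_all:
  assumes "definable_term t" and P: "definable (\<lambda>e. P (e 0) (\<lambda>i. e (Suc i)))"
  shows "definable (\<lambda>e. \<forall>x. x \<prec> t e \<longrightarrow> P x e)"
proof -
  obtain E p a \<theta> where E: "range E \<subseteq> Sets M"
    and a: "\<And>e. term_val M (interleave e p) a = t e"
    and \<theta>: "\<And>e. sat M E (interleave e p) \<theta> \<longleftrightarrow> P (e 0) (\<lambda>i. e (Suc i))"
    using definable_common_term[OF P assms(1)] unfolding term_over_def bounded_over_def by metis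
  let ?\<theta> = "rename_formula id (\<lambda>i. if i = 0 then 0 else if even i then i - 1 else i + 1) \<theta>"
  have "sat M E (case_nat x (interleave e p)) ?\<theta> \<longleftrightarrow> P x e" for x e
    using \<theta>[of "case_nat x e"] by (simp add: interleave_case_nat)
  then have "sat M E (interleave e p) (BAll a ?\<theta>) \<longleftrightarrow> (\<forall>x. x \<prec> t e \<longrightarrow> P x e)" for e
    by (simp only: sat.simps a)
  then show ?thesis
    unfolding definable_def bounded_over_def using E by (intro exI conjI allI)
qed

lemma definable_ex:
  assumes "definable_term t" "definable (\<lambda>e. P (e 0) (\<lambda>i. e (Suc i)))"
  shows "definable (\<lambda>e. \<exists>x. x \<prec> t e \<and> P x e)"
proof -
  have "definable (\<lambda>e. \<not> (\<forall>x. x \<prec> t e \<longrightarrow> \<not> P x e))"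
    by (intro definable_not definable_all assms)
  then show ?thesis by simp
qed

text \<open>
  The axiom schemes read the existential variable from position 0, the free variable from position 1
  and the parameters from position 2 on. Only the first two arguments of a binary predicate matter,
  so the remaining even positions may be filled with any value at hand.
\<close>

lemma interleave_pair_env:
  "interleave (\<lambda>i. if i = 1 then n else m) p =
     case_nat m (case_nat n p) \<circ> (\<lambda>i. if i = 2 then 1 else if even i then 0 else i div 2 + 2)"
  by (auto simp: interleave_def fun_eq_iff elim!: evenE split: nat.split)

lemma Sigma1_of_bounded:
  assumes "bounded_over M E p (\<lambda>e. P (e 0) (e 1))"
  shows "\<exists>\<theta>. (\<forall>n. Sigma1 M E p \<theta> n \<longleftrightarrow> (\<exists>m. P m n)) \<and> (\<forall>n. Pi1 M E p \<theta> n \<longleftrightarrow> (\<forall>m. P m n))"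
proof -
  obtain \<theta> where \<theta>: "\<And>e. sat M E (interleave e p) \<theta> \<longleftrightarrow> P (e 0) (e 1)"
    using assms unfolding bounded_over_def by metis
  let ?\<theta> = "rename_formula id (\<lambda>i. if i = 2 then 1 else if even i then 0 else i div 2 + 2) \<theta>"
  have "sat M E (case_nat m (case_nat n p)) ?\<theta> \<longleftrightarrow> P m n" for m n
    using \<theta>[of "\<lambda>i. if i = 1 then n else m"] by (simp only: interleave_pair_env) simp
  then show ?thesis
    by (intro exI[of _ ?\<theta>]) (simp only: Sigma1_def Pi1_def simp_thms)
qed

lemma Sigma1_induct:
  assumes P: "definable (\<lambda>e. P (e 0) (e 1))"
    and 0: "\<exists>m. P m \<zero>" and S: "\<And>n. \<exists>m. P m n \<Longrightarrow> \<exists>m. P m (n \<oplus> \<one>)"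
  shows "\<exists>m. P m n"
proof -
  obtain E p where E: "range E \<subseteq> Sets M" and *: "bounded_over M E p (\<lambda>e. P (e 0) (e 1))"
    using P unfolding definable_def by blast
  obtain \<theta> where "\<And>n. Sigma1 M E p \<theta> n \<longleftrightarrow> (\<exists>m. P m n)"
    using Sigma1_of_bounded[OF *] by blast
  moreover have "Sigma1_induction M"
    using model by (simp add: RCA0_model_def)
  then have "Sigma1 M E p \<theta> \<zero> \<longrightarrow>
      (\<forall>n. Sigma1 M E p \<theta> n \<longrightarrow> Sigma1 M E p \<theta> (n \<oplus> \<one>)) \<longrightarrow> (\<forall>n. Sigma1 M E p \<theta> n)"
    unfolding Sigma1_induction_def using E by blast
  ultimately show ?thesis
    using 0 S by simp
qed

lemma definable_at_one: assumes "definable (\<lambda>e. P (e 0))" shows "definable (\<lambda>e. P (e 1))"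
  by (rule definable_rename[OF assms])

lemma bounded_induct:
  assumes P: "definable (\<lambda>e. P (e 0))" and "P \<zero>" "\<And>n. P n \<Longrightarrow> P (n \<oplus> \<one>)"
  shows "P n"
  using Sigma1_induct[where P = "\<lambda>m. P", OF definable_at_one[OF P]] assms(2,3) by blast

lemma Delta1_set:
  assumes P: "definable (\<lambda>e. P (e 0) (e 1))" and Q: "definable (\<lambda>e. Q (e 0) (e 1))"
    and "\<And>n. (\<exists>m. P m n) \<longleftrightarrow> (\<forall>m. Q m n)"
  shows "{n. \<exists>m. P m n} \<in> Sets M"
proof -
  obtain E p where E: "range E \<subseteq> Sets M"
    and *: "bounded_over M E p (\<lambda>e. P (e 0) (e 1))" "bounded_over M E p (\<lambda>e. Q (e 0) (e 1))"
    using definable_common[OF P Q] by blast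
  obtain \<theta> where \<theta>: "\<And>n. Sigma1 M E p \<theta> n \<longleftrightarrow> (\<exists>m. P m n)"
    using Sigma1_of_bounded[OF *(1)] by blast
  obtain \<psi> where \<psi>: "\<And>n. Pi1 M E p \<psi> n \<longleftrightarrow> (\<forall>m. Q m n)"
    using Sigma1_of_bounded[OF *(2)] by blast
  have "Delta1_comprehension M"
    using model by (simp add: RCA0_model_def)
  moreover have "Sigma1 M E p \<theta> n \<longleftrightarrow> Pi1 M E p \<psi> n" for n
    by (simp only: \<theta> \<psi> assms(3))
  ultimately have "{n. Sigma1 M E p \<theta> n} \<in> Sets M"
    unfolding Delta1_comprehension_def using E by blast
  then show ?thesis by (simp add: \<theta>)
qed

lemma bounded_set: assumes "definable (\<lambda>e. P (e 0))" shows "{n. P n} \<in> Sets M"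
  using Delta1_set[where P = "\<lambda>m. P" and Q = "\<lambda>m. P", OF definable_at_one definable_at_one, OF assms assms]
  by simp

section \<open>The discretely ordered semiring of numbers\<close>

lemmas definable_basics = definable_all definable_ex definable_eq definable_less 
  definable_conj definable_disj definable_imp definable_iff definable_not definable_mem
  definable_term_var definable_term_plus definable_term_times definable_term_const

definition leq (infix "\<preceq>" 50) where "a \<preceq> b \<longleftrightarrow> a \<prec> b \<or> a = b"

lemma basic: "n \<oplus> \<one> \<noteq> \<zero>" "m \<oplus> \<one> = n \<oplus> \<one> \<longleftrightarrow> m = n" "m \<oplus> \<zero> = m"
  "m \<oplus> (n \<oplus> \<one>) = (m \<oplus> n) \<oplus> \<one>" "m \<otimes> \<zero> = \<zero>" "m \<otimes> (n \<oplus> \<one>) = (m \<otimes> n) \<oplus> m"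
  "\<not> m \<prec> \<zero>" "m \<prec> n \<oplus> \<one> \<longleftrightarrow> m \<prec> n \<or> m = n"
  using model unfolding RCA0_model_def basic_axioms_def by metis+

lemma zero_plus: "\<zero> \<oplus> n = n"
  by (rule bounded_induct[where n = n]) (intro definable_basics | simp add: basic)+

lemma succ_plus: "(m \<oplus> \<one>) \<oplus> n = (m \<oplus> n) \<oplus> \<one>"
  by (rule bounded_induct[where n = n]) (intro definable_basics | simp add: basic)+

lemma plus_comm: "m \<oplus> n = n \<oplus> m"
  by (rule bounded_induct[where n = n]) (intro definable_basics | simp add: basic zero_plus succ_plus)+

lemma plus_assoc: "(m \<oplus> n) \<oplus> k = m \<oplus> (n \<oplus> k)"
  by (rule bounded_induct[where n = k]) (intro definable_basics | simp add: basic)+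

lemma zero_times: "\<zero> \<otimes> n = \<zero>"
  by (rule bounded_induct[where n = n]) (intro definable_basics | simp add: basic)+

lemma plus_left_comm: "m \<oplus> (n \<oplus> k) = n \<oplus> (m \<oplus> k)"
  by (metis plus_comm plus_assoc)

lemma succ_times: "(m \<oplus> \<one>) \<otimes> n = m \<otimes> n \<oplus> n"
proof (rule bounded_induct[where n = n])
  show "(m \<oplus> \<one>) \<otimes> (n \<oplus> \<one>) = m \<otimes> (n \<oplus> \<one>) \<oplus> (n \<oplus> \<one>)"
    if "(m \<oplus> \<one>) \<otimes> n = m \<otimes> n \<oplus> n" for n
    by (simp add: basic(6) that plus_assoc plus_left_comm)
qed (intro definable_basics | simp add: basic)+


lemma times_comm: "m \<otimes> n = n \<otimes> m"
  by (rule bounded_induct[where n = n])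
     (intro definable_basics | simp add: basic zero_times succ_times)+

lemma times_plus: "m \<otimes> (n \<oplus> k) = m \<otimes> n \<oplus> m \<otimes> k"
proof (rule bounded_induct[where n = k])
  show "m \<otimes> (n \<oplus> (k \<oplus> \<one>)) = m \<otimes> n \<oplus> m \<otimes> (k \<oplus> \<one>)"
    if "m \<otimes> (n \<oplus> k) = m \<otimes> n \<oplus> m \<otimes> k" for k
    using that by (simp add: basic(4,6)) (simp add: plus_assoc)
qed (intro definable_basics | simp add: basic)+

lemma times_assoc: "(m \<otimes> n) \<otimes> k = m \<otimes> (n \<otimes> k)"
proof (rule bounded_induct[where n = k])
  show "(m \<otimes> n) \<otimes> (k \<oplus> \<one>) = m \<otimes> (n \<otimes> (k \<oplus> \<one>))"
    if "(m \<otimes> n) \<otimes> k = m \<otimes> (n \<otimes> k)" for k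
    using that by (simp only: basic(6) times_plus[of m "n \<otimes> k" n])
qed (intro definable_basics | simp add: basic)+

lemma one_times: "\<one> \<otimes> n = n"
  by (rule bounded_induct[where n = n])
     (intro definable_basics | simp add: basic(5,6) | simp add: basic)+

lemma zero_less_succ: "\<zero> \<prec> n \<oplus> \<one>"
  by (rule bounded_induct[where n = n])
     (intro definable_basics | simp add: basic)+

lemma zero_or_succ: "n = \<zero> \<or> (\<exists>m. m \<prec> n \<and> n = m \<oplus> \<one>)"
  by (rule bounded_induct[where n = n])
     (intro definable_basics | simp add: basic)+

lemma less_transitive: "a \<prec> b \<Longrightarrow> b \<prec> c \<Longrightarrow> a \<prec> c"
proof -
  have "a \<prec> b \<longrightarrow> b \<prec> c \<longrightarrow> a \<prec> c"
    by (rule bounded_induct[where n = c]) ((intro definable_basics) | auto simp: basic)+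
  then show "a \<prec> b \<Longrightarrow> b \<prec> c \<Longrightarrow> a \<prec> c" by blast
qed

lemma less_irreflexive: "\<not> n \<prec> n"
proof (rule bounded_induct[where n = n])
  show "\<not> n \<oplus> \<one> \<prec> n \<oplus> \<one>" if "\<not> n \<prec> n" for n
    using that less_transitive[of n "n \<oplus> \<one>" n] by (metis basic(8))
qed ((intro definable_basics) | simp add: basic)+

lemma succ_less_succ: "a \<prec> b \<Longrightarrow> a \<oplus> \<one> \<prec> b \<oplus> \<one>"
proof -
  have "a \<prec> b \<longrightarrow> a \<oplus> \<one> \<prec> b \<oplus> \<one>"
    by (rule bounded_induct[where n = b]) ((intro definable_basics) | auto simp: basic)+
  then show "a \<prec> b \<Longrightarrow> a \<oplus> \<one> \<prec> b \<oplus> \<one>" by blast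
qed

lemma less_trichotomy: "a \<prec> b \<or> a = b \<or> b \<prec> a"
proof (rule bounded_induct[where n = b])
  show "a \<prec> \<zero> \<or> a = \<zero> \<or> \<zero> \<prec> a"
    using zero_or_succ[of a] zero_less_succ by metis
  show "a \<prec> n \<oplus> \<one> \<or> a = n \<oplus> \<one> \<or> n \<oplus> \<one> \<prec> a" if "a \<prec> n \<or> a = n \<or> n \<prec> a" for n
    using that succ_less_succ[of n a] by (auto simp: basic)
qed ((intro definable_basics) | simp add: basic)+

lemma plus_less_mono: "a \<prec> b \<Longrightarrow> c \<oplus> a \<prec> c \<oplus> b"
proof -
  assume "a \<prec> b"
  then have "a \<oplus> c \<prec> b \<oplus> c"
    by - (rule bounded_induct[where n = c], (intro definable_basics | simp add: basic(3,4) succ_less_succ)+)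
  then show ?thesis by (metis plus_comm)
qed

lemma less_difference: "a \<prec> b \<Longrightarrow> \<exists>d. d \<oplus> a = b"
proof -
  have "a \<prec> b \<longrightarrow> (\<exists>d. d \<prec> b \<oplus> \<one> \<and> d \<oplus> a = b)"
  proof (rule bounded_induct[where n = b])
    show "a \<prec> n \<oplus> \<one> \<longrightarrow> (\<exists>d. d \<prec> n \<oplus> \<one> \<oplus> \<one> \<and> d \<oplus> a = n \<oplus> \<one>)"
      if IH: "a \<prec> n \<longrightarrow> (\<exists>d. d \<prec> n \<oplus> \<one> \<and> d \<oplus> a = n)" for n
    proof
      assume "a \<prec> n \<oplus> \<one>"
      then consider "a \<prec> n" | "a = n" by (auto simp: basic)
      then show "\<exists>d. d \<prec> n \<oplus> \<one> \<oplus> \<one> \<and> d \<oplus> a = n \<oplus> \<one>"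
      proof cases
        case 1
        then obtain d where "d \<prec> n \<oplus> \<one>" "d \<oplus> a = n" using IH by blast
        then show ?thesis
          by (intro exI[of _ "d \<oplus> \<one>"]) (metis succ_less_succ succ_plus)
      next
        case 2
        then show ?thesis
          using succ_less_succ[OF zero_less_succ[of n]]
          by (intro exI[of _ \<one>]) (metis zero_plus plus_comm)
      qed
    qed
  qed ((intro definable_basics) | simp add: basic)+
  then show "a \<prec> b \<Longrightarrow> \<exists>d. d \<oplus> a = b" by blast
qed

lemma times_less_mono: assumes "a \<prec> b" "\<zero> \<prec> c" shows "c \<otimes> a \<prec> c \<otimes> b"
proof -
  obtain d where d: "d \<oplus> a = b" using less_difference assms(1) by blast
  have "d \<noteq> \<zero>" using d assms(1) less_irreflexive zero_plus by metis
  then obtain d' where d': "d = d' \<oplus> \<one>" using zero_or_succ by blast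
  have "c \<otimes> a \<oplus> \<zero> \<prec> c \<otimes> a \<oplus> (c \<otimes> d' \<oplus> c)"
  proof (rule plus_less_mono)
    have "\<zero> \<prec> c \<oplus> c \<otimes> d'"
      using plus_less_mono[of \<zero> "c \<otimes> d'" c] assms(2) less_transitive zero_or_succ zero_less_succ
      by (metis basic(3))
    then show "\<zero> \<prec> c \<otimes> d' \<oplus> c" by (metis plus_comm)
  qed
  moreover have "c \<otimes> a \<oplus> (c \<otimes> d' \<oplus> c) = c \<otimes> b"
    unfolding d[symmetric] d' times_plus[of c "d' \<oplus> \<one>" a] basic(6) by (rule plus_comm)
  ultimately show ?thesis by (simp only: basic(3))
qed

text \<open>
  Truncated subtraction. The class \<open>linordered_semidom\<close> has a subtraction among its operations;
  interpreting the class in the model provides the arithmetic of ordered semirings together with its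
  simplification rules.
\<close>

definition monus (infixl "\<ominus>" 65) where
  "a \<ominus> b = (if b \<prec> a then SOME d. d \<oplus> b = a else \<zero>)"

lemma monus_plus: "b \<preceq> a \<Longrightarrow> (a \<ominus> b) \<oplus> b = a"
  unfolding monus_def leq_def using less_difference[of b a]
  by (auto intro: someI2_ex simp: zero_plus less_irreflexive)

lemma plus_cancel: "c \<oplus> a = c \<oplus> b \<longleftrightarrow> a = b"
  using plus_less_mono less_trichotomy less_irreflexive by metis

lemma monus_eqI: assumes "b \<oplus> d = a" shows "a \<ominus> b = d"
proof -
  have "b \<preceq> a"
    using assms zero_or_succ[of d] plus_less_mono[of \<zero> d b] zero_less_succ basic(3) leq_def by metis
  then show ?thesis
    using monus_plus[of b a] assms plus_comm plus_cancel by metis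
qed

lemma monus_eq_zero: "a \<preceq> b \<Longrightarrow> a \<ominus> b = \<zero>"
  unfolding monus_def leq_def using less_transitive less_irreflexive by metis

lemma monus_monus: "a \<ominus> b \<ominus> c = a \<ominus> (b \<oplus> c)"
proof (cases "b \<preceq> a \<and> c \<preceq> a \<ominus> b")
  case True
  then have "(b \<oplus> c) \<oplus> (a \<ominus> b \<ominus> c) = a"
    using monus_plus by (metis plus_comm plus_assoc)
  then show ?thesis using monus_eqI by metis
next
  case False
  show ?thesis
  proof (cases "b \<preceq> a")
    case True
    with False have "a \<ominus> b \<prec> c" using less_trichotomy leq_def by blast
    moreover from this True have "a \<prec> b \<oplus> c"
      using plus_less_mono monus_plus plus_comm by metis
    ultimately show ?thesis by (simp add: monus_eq_zero leq_def)
  next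
    case False
    then have "a \<prec> b" using less_trichotomy leq_def by blast
    moreover have "b \<preceq> b \<oplus> c"
      using zero_or_succ[of c] plus_less_mono[of \<zero> c b] zero_less_succ basic(3) leq_def by metis
    ultimately show ?thesis
      using less_transitive leq_def by (metis monus_eq_zero zero_or_succ zero_less_succ)
  qed
qed

lemma times_monus: "a \<otimes> (b \<ominus> c) = a \<otimes> b \<ominus> a \<otimes> c"
proof (cases "c \<preceq> b")
  case True
  then have "a \<otimes> c \<oplus> a \<otimes> (b \<ominus> c) = a \<otimes> b"
    by (metis monus_plus times_plus plus_comm)
  then show ?thesis using monus_eqI by metis
next
  case False
  then have "b \<prec> c" using less_trichotomy leq_def by blast
  moreover from this have "a \<otimes> b \<preceq> a \<otimes> c"
    by (metis times_less_mono zero_or_succ zero_less_succ zero_times leq_def)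
  ultimately show ?thesis by (simp add: monus_eq_zero basic(5) leq_def)
qed

lemma plus_times: "(a \<oplus> b) \<otimes> c = a \<otimes> c \<oplus> b \<otimes> c"
  by (metis times_comm times_plus)

lemma plus_leq_mono: "a \<preceq> b \<Longrightarrow> c \<oplus> a \<preceq> c \<oplus> b"
  by (auto simp: leq_def plus_less_mono)

lemma no_zero_divisors: "a \<noteq> \<zero> \<Longrightarrow> b \<noteq> \<zero> \<Longrightarrow> a \<otimes> b \<noteq> \<zero>"
  by (metis zero_or_succ basic(1) basic(4) basic(6))

sublocale ar: linordered_semidom "(\<oplus>)" monus leq "(\<prec>)" \<zero> "(\<otimes>)" \<one>
proof (unfold_locales, goal_cases)
  fix x y z
  show "(x \<prec> y) = (x \<preceq> y \<and> \<not> y \<preceq> x)"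
    using less_transitive less_irreflexive unfolding leq_def by metis
  show "x \<preceq> x" by (simp add: leq_def)
  show "x \<preceq> y \<Longrightarrow> y \<preceq> z \<Longrightarrow> x \<preceq> z"
    using less_transitive unfolding leq_def by metis
  show "x \<preceq> y \<Longrightarrow> y \<preceq> x \<Longrightarrow> x = y"
    using less_transitive less_irreflexive unfolding leq_def by metis
  show "x \<preceq> y \<or> y \<preceq> x"
    using less_trichotomy unfolding leq_def by metis
  show "\<zero> \<noteq> \<one>" "\<zero> \<prec> \<one>"
    using basic(1)[of \<zero>] zero_less_succ[of \<zero>] by (auto simp: zero_plus)
qed (rule plus_assoc plus_comm monus_monus zero_plus times_assoc times_comm one_times
  zero_times times_monus times_plus plus_times times_less_mono monus_plus plus_leq_mono
  no_zero_divisors monus_eqI basic(5) refl; assumption?)+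

lemma definable_leq: "definable_term s \<Longrightarrow> definable_term t \<Longrightarrow> definable (\<lambda>e. s e \<preceq> t e)"
  unfolding leq_def by (intro definable_basics)

lemma less_succ_iff: "a \<prec> b \<oplus> \<one> \<longleftrightarrow> a \<preceq> b"
  unfolding leq_def by (rule basic(8))

lemma definable_all_leq:
  "definable_term t \<Longrightarrow> definable (\<lambda>e. P (e 0) (\<lambda>i. e (Suc i))) \<Longrightarrow> definable (\<lambda>e. \<forall>x. x \<preceq> t e \<longrightarrow> P x e)"
  unfolding less_succ_iff[symmetric] by (intro definable_basics)

lemma definable_ex_leq:
  "definable_term t \<Longrightarrow> definable (\<lambda>e. P (e 0) (\<lambda>i. e (Suc i))) \<Longrightarrow> definable (\<lambda>e. \<exists>x. x \<preceq> t e \<and> P x e)"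
  unfolding less_succ_iff[symmetric] by (intro definable_basics)

lemma succ_leq_iff: "a \<oplus> \<one> \<preceq> b \<longleftrightarrow> a \<prec> b"
  by (metis less_succ_iff ar.add_less_cancel_right ar.not_less)

lemma zero_leq [simp]: "\<zero> \<preceq> a"
  using zero_or_succ zero_less_succ leq_def by metis

lemma pos_iff: "\<zero> \<prec> a \<longleftrightarrow> a \<noteq> \<zero>"
  using zero_leq leq_def less_irreflexive by metis

lemma leq_plus [simp]: "a \<preceq> a \<oplus> b" "a \<preceq> b \<oplus> a"
  by simp_all

lemma least_number:
  assumes "definable (\<lambda>e. P (e 0))" and "P a"
  shows "\<exists>m. P m \<and> m \<preceq> a \<and> (\<forall>x. x \<prec> m \<longrightarrow> \<not> P x)"
proof -
  have "(\<exists>m. m \<prec> n \<and> P m) \<longrightarrow> (\<exists>m. m \<prec> n \<and> P m \<and> (\<forall>x. x \<prec> m \<longrightarrow> \<not> P x))" for n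
  proof (rule bounded_induct[where n = n])
    show "definable (\<lambda>e. (\<exists>m. m \<prec> e 0 \<and> P m) \<longrightarrow> (\<exists>m. m \<prec> e 0 \<and> P m \<and> (\<forall>x. x \<prec> m \<longrightarrow> \<not> P x)))"
      by (intro definable_basics assms)
  qed (simp add: basic, metis basic(8))
  from this[of "a \<oplus> \<one>"] show ?thesis
    using assms(2) ar.order_refl unfolding less_succ_iff by blast
qed

lemmas definability = definable_all_leq definable_ex_leq definable_leq definable_basics

text \<open>
  A term is substituted for a variable by quantifying over a number that is bounded by the term and
  equal to it.
\<close>

lemma definable_subst2:
  assumes "definable (\<lambda>e. R (e 0) (e 1))" "definable_term s" "definable_term t"
  shows "definable (\<lambda>e. R (s e) (t e))"
proof -
  have "definable (\<lambda>e. R (e 1) (e 0))"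
    using definable_rename[OF assms(1), where r = "\<lambda>i. 1 - i"] by simp
  then have "definable (\<lambda>e. \<exists>x. x \<preceq> s e \<and> (x = s e \<and> (\<exists>y. y \<preceq> t e \<and> (y = t e \<and> R x y))))"
    by (intro definability assms definable_term_shift) simp
  then show ?thesis by simp
qed

section \<open>Division and pairing\<close>

lemma division: assumes "\<zero> \<prec> d" shows "\<exists>q r. q \<preceq> a \<and> r \<prec> d \<and> a = q \<otimes> d \<oplus> r"
proof -
  have "\<exists>q. q \<prec> a \<oplus> \<one> \<and> (\<exists>r. r \<prec> d \<and> a = q \<otimes> d \<oplus> r)"
  proof (rule bounded_induct[where n = a])
    show "definable (\<lambda>e. \<exists>q. q \<prec> e 0 \<oplus> \<one> \<and> (\<exists>r. r \<prec> d \<and> e 0 = q \<otimes> d \<oplus> r))"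
      by (intro definable_basics)
    show "\<exists>q. q \<prec> \<zero> \<oplus> \<one> \<and> (\<exists>r. r \<prec> d \<and> \<zero> = q \<otimes> d \<oplus> r)"
      using assms by (intro exI[of _ \<zero>]) auto
  next
    fix a assume "\<exists>q. q \<prec> a \<oplus> \<one> \<and> (\<exists>r. r \<prec> d \<and> a = q \<otimes> d \<oplus> r)"
    then obtain q r where q: "q \<prec> a \<oplus> \<one>" and r: "r \<prec> d" "a = q \<otimes> d \<oplus> r" by blast
    show "\<exists>q. q \<prec> a \<oplus> \<one> \<oplus> \<one> \<and> (\<exists>r. r \<prec> d \<and> a \<oplus> \<one> = q \<otimes> d \<oplus> r)"
    proof (cases "r \<oplus> \<one> = d")
      case True
      have "a \<oplus> \<one> = (q \<oplus> \<one>) \<otimes> d \<oplus> \<zero>"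
        by (simp add: r(2) ar.distrib_right ar.add_assoc True)
      moreover have "q \<oplus> \<one> \<prec> a \<oplus> \<one> \<oplus> \<one>"
        using q by simp
      ultimately show ?thesis using assms by blast
    next
      case False
      then have "r \<oplus> \<one> \<prec> d"
        using r(1) succ_leq_iff leq_def by metis
      moreover have "q \<prec> a \<oplus> \<one> \<oplus> \<one>"
        using q ar.less_trans less_succ_iff ar.order_refl by blast
      ultimately show ?thesis
        using r(2) ar.add_assoc by metis
    qed
  qed
  then show ?thesis by (auto simp: less_succ_iff)
qed

lemma division_unique:
  assumes eq: "q \<otimes> d \<oplus> r = q' \<otimes> d \<oplus> r'" and r: "r \<prec> d" "r' \<prec> d"
  shows "q = q' \<and> r = r'"
proof -
  have "\<not> q \<prec> q'" if "q \<otimes> d \<oplus> r = q' \<otimes> d \<oplus> r'" "r \<prec> d" for q q' r r'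
  proof
    assume "q \<prec> q'"
    then have "(q \<oplus> \<one>) \<otimes> d \<preceq> q' \<otimes> d"
      by (simp only: succ_leq_iff ar.mult_right_mono zero_leq)
    moreover have "q \<otimes> d \<oplus> r \<prec> (q \<oplus> \<one>) \<otimes> d"
      using that(2) by (simp add: ar.distrib_right)
    moreover have "q' \<otimes> d \<preceq> q' \<otimes> d \<oplus> r'" by simp
    ultimately show False using that(1) by (metis ar.leD ar.order_trans)
  qed
  from this[OF eq r(1)] this[OF eq[symmetric] r(2)] have "q = q'"
    using ar.not_less_iff_gr_or_eq by blast
  then show ?thesis using eq by simp
qed

lemma square_geq: "a \<preceq> a \<otimes> a"
proof (cases "a = \<zero>")
  case False
  then have "\<one> \<preceq> a" using succ_leq_iff[of \<zero> a] by (simp add: pos_iff)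
  then show ?thesis using ar.mult_left_mono[of \<one> a a] by simp
qed simp

lemma pair_geq: "i \<preceq> pair_in M i j" "j \<preceq> pair_in M i j"
proof -
  have "j \<preceq> i \<oplus> j" by simp
  also have "\<dots> \<preceq> (i \<oplus> j) \<otimes> (i \<oplus> j)" by (rule square_geq)
  also have "\<dots> \<preceq> pair_in M i j" by (simp add: pair_in_def)
  finally show "j \<preceq> pair_in M i j" .
qed (simp add: pair_in_def)

lemma pair_mono: "i \<preceq> i' \<Longrightarrow> j \<preceq> j' \<Longrightarrow> pair_in M i j \<preceq> pair_in M i' j'"
  unfolding pair_in_def by (intro ar.add_mono ar.mult_mono) auto

text \<open>
  The sum \<open>s = i + j\<close> can be recovered from \<open>s\<^sup>2 + i\<close>, since this number lies between
  \<open>s\<^sup>2\<close> and \<open>s\<^sup>2 + s < (s + 1)\<^sup>2\<close>.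
\<close>

lemma pair_inject: "pair_in M i j = pair_in M i' j' \<longleftrightarrow> i = i' \<and> j = j'"
proof
  have "\<not> i \<oplus> j \<prec> i' \<oplus> j'" if "pair_in M i j = pair_in M i' j'" for i j i' j'
  proof
    let ?s = "i \<oplus> j"
    assume "?s \<prec> i' \<oplus> j'"
    then have "(?s \<oplus> \<one>) \<otimes> (?s \<oplus> \<one>) \<preceq> (i' \<oplus> j') \<otimes> (i' \<oplus> j')"
      by (intro ar.mult_mono) (simp_all only: succ_leq_iff zero_leq)
    also have "\<dots> \<preceq> pair_in M i' j'" by (simp add: pair_in_def)
    also have "\<dots> = ?s \<otimes> ?s \<oplus> i" using that by (simp add: pair_in_def)
    also have "\<dots> \<prec> ?s \<otimes> ?s \<oplus> (?s \<oplus> (?s \<oplus> \<one>))"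
    proof (rule ar.add_strict_left_mono)
      have "i \<prec> ?s \<oplus> \<one>" by (simp only: less_succ_iff leq_plus)
      also have "\<dots> \<preceq> ?s \<oplus> (?s \<oplus> \<one>)" by (rule leq_plus)
      finally show "i \<prec> ?s \<oplus> (?s \<oplus> \<one>)" .
    qed
    also have "\<dots> = (?s \<oplus> \<one>) \<otimes> (?s \<oplus> \<one>)"
      by (simp only: ar.distrib_left ar.distrib_right ar.mult_1_left ar.mult_1_right ar.add_ac)
    finally show False by simp
  qed
  moreover assume eq: "pair_in M i j = pair_in M i' j'"
  ultimately have "i \<oplus> j = i' \<oplus> j'"
    using ar.not_less_iff_gr_or_eq by metis
  moreover from this eq have "i = i'" by (simp add: pair_in_def)
  ultimately show "i = i' \<and> j = j'" by simp
qed simp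

section \<open>The beta function and the Chinese remainder theorem\<close>

definition modulus :: "'a \<Rightarrow> 'a \<Rightarrow> 'a" where
  "modulus b i = (i \<oplus> \<one>) \<otimes> b \<oplus> \<one>"

lemma modulus_pos [simp]: "\<zero> \<prec> modulus b i"
  by (simp add: modulus_def less_succ_iff)

lemma definable_term_modulus: "definable_term s \<Longrightarrow> definable_term t \<Longrightarrow> definable_term (\<lambda>e. modulus (s e) (t e))"
  unfolding modulus_def by (intro definability)

lemma leq_times_pos: "\<zero> \<prec> d \<Longrightarrow> q \<preceq> q \<otimes> d"
  using ar.mult_left_mono[of \<one> d q] succ_leq_iff[of \<zero> d] by simp

lemma beta_in_iff: "beta_in M a b i c \<longleftrightarrow> c \<prec> modulus b i \<and> (\<exists>q. a = q \<otimes> modulus b i \<oplus> c)"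
  by (simp add: beta_in_def modulus_def Let_def)

lemma beta_in_bounded_iff:
  "beta_in M a b i c \<longleftrightarrow> c \<prec> modulus b i \<and> (\<exists>q. q \<preceq> a \<and> a = q \<otimes> modulus b i \<oplus> c)"
  unfolding beta_in_iff
  using leq_times_pos[OF modulus_pos] leq_plus ar.order_trans by metis

lemma definable_beta_in:
  "definable_term s \<Longrightarrow> definable_term t \<Longrightarrow> definable_term u \<Longrightarrow> definable_term v \<Longrightarrow>
    definable (\<lambda>e. beta_in M (s e) (t e) (u e) (v e))"
  unfolding beta_in_bounded_iff by (intro definability definable_term_modulus definable_term_shift)

lemma beta_in_ex: "\<exists>c. beta_in M a b i c"
  using division[OF modulus_pos, of a b i] by (auto simp: beta_in_iff)

lemma beta_in_unique: "beta_in M a b i c \<Longrightarrow> beta_in M a b i c' \<Longrightarrow> c = c'"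
  unfolding beta_in_iff using division_unique by metis

text \<open>
  Congruence is expressed by adding multiples of the modulus on both sides, because subtraction is
  truncated.
\<close>

lemma beta_in_cong:
  assumes a: "beta_in M a b i c" and eq: "a' \<oplus> x \<otimes> modulus b i = a \<oplus> y \<otimes> modulus b i"
  shows "beta_in M a' b i c"
proof -
  let ?d = "modulus b i"
  obtain q where q: "c \<prec> ?d" "a = q \<otimes> ?d \<oplus> c" using a by (auto simp: beta_in_iff)
  obtain c' where c': "beta_in M a' b i c'" using beta_in_ex by blast
  then obtain q' where q': "c' \<prec> ?d" "a' = q' \<otimes> ?d \<oplus> c'" by (auto simp: beta_in_iff)
  have "(q' \<oplus> x) \<otimes> ?d \<oplus> c' = (q \<oplus> y) \<otimes> ?d \<oplus> c"
    using eq by (simp add: q(2) q'(2) algebra_simps)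
  then have "c' = c" using division_unique q(1) q'(1) by blast
  then show ?thesis using c' by simp
qed

lemma beta_in_times:
  assumes a: "beta_in M a b i \<one>" and a': "beta_in M a' b i c"
  shows "beta_in M (a \<otimes> a') b i c"
proof -
  obtain q where "a = q \<otimes> modulus b i \<oplus> \<one>" using a by (auto simp: beta_in_iff)
  then have "a \<otimes> a' \<oplus> \<zero> \<otimes> modulus b i = a' \<oplus> (q \<otimes> a') \<otimes> modulus b i"
    by (simp add: algebra_simps)
  then show ?thesis using beta_in_cong a' by blast
qed

text \<open>
  The quotient is bounded so that the predicate is definable by a bounded formula.
\<close>

definition divides :: "'a \<Rightarrow> 'a \<Rightarrow> bool" where
  "divides d a \<longleftrightarrow> (\<exists>q. q \<preceq> a \<and> a = q \<otimes> d)"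

lemma definable_divides: "definable_term s \<Longrightarrow> definable_term t \<Longrightarrow> definable (\<lambda>e. divides (s e) (t e))"
  unfolding divides_def by (intro definability definable_term_shift)

lemma divides_iff: "\<zero> \<prec> d \<Longrightarrow> divides d a \<longleftrightarrow> (\<exists>q. a = q \<otimes> d)"
  unfolding divides_def using leq_times_pos by metis

lemma divides_times: "divides d a \<Longrightarrow> divides d (a \<otimes> c)"
proof (cases "c = \<zero>")
  case True
  then show ?thesis unfolding divides_def by (intro exI[of _ \<zero>]) simp
next
  case False
  assume "divides d a"
  then obtain q where "q \<preceq> a" "a = q \<otimes> d" by (auto simp: divides_def)
  then show ?thesis unfolding divides_def
    using ar.mult_right_mono[of q a c] by (intro exI[of _ "q \<otimes> c"]) (simp add: ar.mult_ac)
qed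

definition multiple_upto :: "'a \<Rightarrow> 'a \<Rightarrow> bool" where
  "multiple_upto n b \<longleftrightarrow> \<zero> \<prec> b \<and> (\<forall>h. h \<prec> n \<longrightarrow> divides (h \<oplus> \<one>) b)"

lemma definable_multiple_upto: "definable_term s \<Longrightarrow> definable_term t \<Longrightarrow> definable (\<lambda>e. multiple_upto (s e) (t e))"
  unfolding multiple_upto_def by (intro definability definable_divides definable_term_shift)

lemma ex_multiple_upto: "\<exists>b. C \<preceq> b \<and> multiple_upto n b"
proof (rule Sigma1_induct[where n = n])
  show "definable (\<lambda>e. C \<preceq> e 0 \<and> multiple_upto (e 1) (e 0))"
    by (intro definability definable_multiple_upto)
  show "\<exists>b. C \<preceq> b \<and> multiple_upto \<zero> b"
    unfolding multiple_upto_def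
    by (intro exI[of _ "C \<oplus> \<one>"]) (simp add: less_succ_iff basic)
next
  fix n assume "\<exists>b. C \<preceq> b \<and> multiple_upto n b"
  then obtain b where b: "C \<preceq> b" "\<zero> \<prec> b" "\<And>h. h \<prec> n \<Longrightarrow> divides (h \<oplus> \<one>) b"
    by (auto simp: multiple_upto_def)
  have pos: "\<zero> \<prec> n \<oplus> \<one>" by (simp add: less_succ_iff)
  have "divides (h \<oplus> \<one>) (b \<otimes> (n \<oplus> \<one>))" if "h \<prec> n \<oplus> \<one>" for h
  proof (cases "h = n")
    case True
    then show ?thesis using pos divides_iff by blast
  next
    case False
    then show ?thesis using that b(3) divides_times less_succ_iff leq_def by blast
  qed
  moreover have "C \<preceq> b \<otimes> (n \<oplus> \<one>)"
    using b(1) leq_times_pos[OF pos] ar.order_trans by blast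
  ultimately show "\<exists>b. C \<preceq> b \<and> multiple_upto (n \<oplus> \<one>) b"
    unfolding multiple_upto_def using b(2) pos by (metis ar.mult_pos_pos)
qed

lemma one_less_modulus: "\<zero> \<prec> b \<Longrightarrow> \<one> \<prec> modulus b i"
  unfolding modulus_def using ar.mult_pos_pos[of "i \<oplus> \<one>" b] by (simp add: less_succ_iff)

lemma less_modulus: "b \<prec> modulus b i"
  using leq_times_pos[of "i \<oplus> \<one>" b] by (simp add: modulus_def less_succ_iff ar.mult.commute)

lemma beta_in_less: "c \<prec> modulus b i \<Longrightarrow> beta_in M c b i c"
  by (auto simp: beta_in_iff intro: exI[of _ \<zero>])

text \<open>
  The usual reason why the moduli are coprime: \<open>j - i\<close> divides \<open>b\<close>, say
  \<open>b = g (j - i)\<close>, and modulo \<open>d\<^sub>j = (j + 1) b + 1\<close> the number \<open>b\<close> has the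
  inverse \<open>-(j + 1)\<close>. Hence \<open>d\<^sub>i \<equiv> -(j - i) b\<close> has the inverse
  \<open>-g (j + 1)\<^sup>2\<close>. The factor \<open>-1\<close> is replaced by \<open>d\<^sub>j - 1 = (j + 1) b\<close>, so
  that everything stays in the semiring.
\<close>

lemma modulus_invertible:
  assumes b: "multiple_upto n b" and ij: "i \<prec> j" "j \<prec> n"
  shows "\<exists>u. beta_in M (modulus b i \<otimes> u) b j \<one>"
proof -
  obtain h where h: "j = i \<oplus> (h \<oplus> \<one>)"
    using less_difference[OF ij(1)] ij(1) zero_or_succ
    by (metis ar.add.commute ar.add_0 ar.less_irrefl)
  have "h \<prec> h \<oplus> \<one>" by (simp add: less_succ_iff)
  also have "\<dots> \<preceq> j" by (simp add: h)
  finally have "h \<prec> n" using ij(2) ar.less_trans by blast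
  then obtain g where g: "b = g \<otimes> (h \<oplus> \<one>)"
    using b by (auto simp: multiple_upto_def divides_def)
  define I H J where "I = i \<oplus> \<one>" and "H = h \<oplus> \<one>" and "J = j \<oplus> \<one>"
  have J: "J = I \<oplus> H" by (simp add: I_def H_def J_def h ar.add_ac)
  have b_eq: "b = g \<otimes> H" by (simp add: g H_def)
  have mi: "modulus b i = I \<otimes> b \<oplus> \<one>" and mj: "modulus b j = J \<otimes> b \<oplus> \<one>"
    by (simp_all add: modulus_def I_def J_def)
  \<comment> \<open>\<open>?w\<close> is the cofactor of \<open>d\<^sub>j\<close> in \<open>d\<^sub>i g J\<^sup>2 + 1\<close>.\<close>
  let ?w = "g \<otimes> J \<otimes> I \<oplus> \<one>"
  have "modulus b i \<otimes> (g \<otimes> J \<otimes> J) \<oplus> \<one> = modulus b j \<otimes> ?w"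
    unfolding mi mj unfolding b_eq J by (simp add: algebra_simps)
  then have *: "(modulus b i \<otimes> (g \<otimes> J \<otimes> J) \<oplus> \<one>) \<otimes> (J \<otimes> b) \<oplus> \<one>
      = modulus b j \<otimes> ?w \<otimes> (J \<otimes> b) \<oplus> \<one>"
    by simp
  have "modulus b i \<otimes> (g \<otimes> J \<otimes> J \<otimes> (J \<otimes> b)) \<oplus> \<one> \<otimes> modulus b j =
      \<one> \<oplus> (?w \<otimes> (J \<otimes> b)) \<otimes> modulus b j"
  proof -
    have "modulus b i \<otimes> (g \<otimes> J \<otimes> J \<otimes> (J \<otimes> b)) \<oplus> \<one> \<otimes> modulus b j =
        (modulus b i \<otimes> (g \<otimes> J \<otimes> J) \<oplus> \<one>) \<otimes> (J \<otimes> b) \<oplus> \<one>"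
      by (simp add: mj ar.distrib_right ar.mult.assoc ar.add.assoc)
    also note *
    finally show ?thesis by (simp add: ar.mult_ac ar.add_ac)
  qed
  moreover have "beta_in M \<one> b j \<one>"
    using b by (intro beta_in_less one_less_modulus) (simp add: multiple_upto_def)
  ultimately show ?thesis using beta_in_cong by blast
qed

definition moduli_product :: "'a \<Rightarrow> 'a \<Rightarrow> 'a \<Rightarrow> bool" where
  "moduli_product m b Q \<longleftrightarrow> \<zero> \<prec> Q \<and> (\<forall>i. i \<prec> m \<longrightarrow> divides (modulus b i) Q)"

lemma definable_moduli_product:
  "definable_term s \<Longrightarrow> definable_term t \<Longrightarrow> definable_term u \<Longrightarrow> definable (\<lambda>e. moduli_product (s e) (t e) (u e))"
  unfolding moduli_product_def by (intro definability definable_divides definable_term_modulus definable_term_shift)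

text \<open>
  Inverses can be chosen below the modulus; this keeps the quantifier over them bounded in the
  induction that builds the product of the moduli.
\<close>

lemma beta_in_reduce_factor:
  assumes "beta_in M (a \<otimes> u) b j c"
  shows "\<exists>u'. u' \<prec> modulus b j \<and> beta_in M (a \<otimes> u') b j c"
proof -
  obtain q u' where u': "u' \<prec> modulus b j" "u = q \<otimes> modulus b j \<oplus> u'"
    using division[OF modulus_pos] by metis
  then have "a \<otimes> u' \<oplus> (a \<otimes> q) \<otimes> modulus b j = a \<otimes> u \<oplus> \<zero> \<otimes> modulus b j"
    by (simp add: algebra_simps)
  then show ?thesis using u'(1) assms beta_in_cong by blast
qed

text \<open>
  Divisibility by the moduli treated so far is proved together with invertibility modulo the
  remaining ones, since the latter is what the Chinese remainder construction needs and what a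
  product inherits from its factors.
\<close>

lemma ex_moduli_product:
  assumes b: "multiple_upto n b" and "m \<preceq> n"
  shows "\<exists>Q. moduli_product m b Q \<and>
    (\<forall>j. j \<prec> n \<longrightarrow> m \<preceq> j \<longrightarrow> (\<exists>u. u \<prec> modulus b j \<and> beta_in M (Q \<otimes> u) b j \<one>))"
proof -
  have "\<exists>Q. m \<preceq> n \<longrightarrow> moduli_product m b Q \<and>
    (\<forall>j. j \<prec> n \<longrightarrow> m \<preceq> j \<longrightarrow> (\<exists>u. u \<prec> modulus b j \<and> beta_in M (Q \<otimes> u) b j \<one>))"
  proof (rule Sigma1_induct[where n = m])
    show "definable (\<lambda>e. e 1 \<preceq> n \<longrightarrow> moduli_product (e 1) b (e 0) \<and>
        (\<forall>j. j \<prec> n \<longrightarrow> e 1 \<preceq> j \<longrightarrow>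
          (\<exists>u. u \<prec> modulus b j \<and> beta_in M (e 0 \<otimes> u) b j \<one>)))"
      by (intro definability definable_moduli_product definable_term_modulus definable_term_shift definable_beta_in)
  next
    have "beta_in M (\<one> \<otimes> \<one>) b j \<one>" "\<one> \<prec> modulus b j" for j
      using b by (simp_all add: beta_in_less one_less_modulus multiple_upto_def)
    then show "\<exists>Q. \<zero> \<preceq> n \<longrightarrow> moduli_product \<zero> b Q \<and>
        (\<forall>j. j \<prec> n \<longrightarrow> \<zero> \<preceq> j \<longrightarrow> (\<exists>u. u \<prec> modulus b j \<and> beta_in M (Q \<otimes> u) b j \<one>))"
      unfolding moduli_product_def by (intro exI[of _ \<one>]) (auto simp: basic(7))
  next
    fix m
    assume IH: "\<exists>Q. m \<preceq> n \<longrightarrow> moduli_product m b Q \<and>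
      (\<forall>j. j \<prec> n \<longrightarrow> m \<preceq> j \<longrightarrow> (\<exists>u. u \<prec> modulus b j \<and> beta_in M (Q \<otimes> u) b j \<one>))"
    show "\<exists>Q. m \<oplus> \<one> \<preceq> n \<longrightarrow> moduli_product (m \<oplus> \<one>) b Q \<and>
      (\<forall>j. j \<prec> n \<longrightarrow> m \<oplus> \<one> \<preceq> j \<longrightarrow> (\<exists>u. u \<prec> modulus b j \<and> beta_in M (Q \<otimes> u) b j \<one>))"
    proof (cases "m \<oplus> \<one> \<preceq> n")
      case True
      then have "m \<preceq> n" by (simp add: succ_leq_iff)
      with IH obtain Q where Q: "moduli_product m b Q"
        and inv: "\<And>j. j \<prec> n \<Longrightarrow> m \<preceq> j \<Longrightarrow> \<exists>u. beta_in M (Q \<otimes> u) b j \<one>"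
        by blast
      have "moduli_product (m \<oplus> \<one>) b (Q \<otimes> modulus b m)"
        unfolding moduli_product_def
      proof (intro conjI allI impI)
        show "\<zero> \<prec> Q \<otimes> modulus b m"
          using Q by (simp add: moduli_product_def ar.mult_pos_pos)
        show "divides (modulus b i) (Q \<otimes> modulus b m)" if "i \<prec> m \<oplus> \<one>" for i
        proof (cases "i = m")
          case True
          then show ?thesis using divides_iff[OF modulus_pos] by blast
        next
          case False
          then show ?thesis
            using that Q divides_times unfolding less_succ_iff leq_def moduli_product_def by blast
        qed
      qed
      moreover have "\<exists>u. u \<prec> modulus b j \<and> beta_in M ((Q \<otimes> modulus b m) \<otimes> u) b j \<one>"
        if j: "j \<prec> n" "m \<oplus> \<one> \<preceq> j" for j
      proof -
        have mj: "m \<prec> j" using j(2) by (simp only: succ_leq_iff)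
        obtain u where u: "beta_in M (Q \<otimes> u) b j \<one>"
          using inv[OF j(1)] mj by (auto simp: leq_def)
        obtain v where v: "beta_in M (modulus b m \<otimes> v) b j \<one>"
          using modulus_invertible[OF b mj j(1)] by blast
        have "beta_in M ((Q \<otimes> modulus b m) \<otimes> (u \<otimes> v)) b j \<one>"
          using beta_in_times[OF u v] by (simp add: ar.mult_ac)
        then show ?thesis by (rule beta_in_reduce_factor)
      qed
      ultimately show ?thesis by blast
    qed blast
  qed
  then show ?thesis using assms(2) by blast
qed

text \<open>
  The pair \<open>(b, P)\<close> serves all sequences of length \<open>n\<close> with values below \<open>C\<close> at
  once: the condition \<open>C \<le> b\<close> makes the values smaller than the moduli, and beta values at
  positions below \<open>n\<close> only depend on residues modulo \<open>P\<close>.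
\<close>

definition code_bound :: "'a \<Rightarrow> 'a \<Rightarrow> 'a \<Rightarrow> 'a \<Rightarrow> bool" where
  "code_bound n C b P \<longleftrightarrow> C \<preceq> b \<and> multiple_upto n b \<and> moduli_product n b P"

lemma definable_code_bound:
  "definable_term s \<Longrightarrow> definable_term t \<Longrightarrow> definable_term u \<Longrightarrow> definable_term v \<Longrightarrow>
    definable (\<lambda>e. code_bound (s e) (t e) (u e) (v e))"
  unfolding code_bound_def by (intro definability definable_multiple_upto definable_moduli_product)

lemma ex_code_bound: "\<exists>b P. code_bound n C b P"
  using ex_multiple_upto[of C n] ex_moduli_product[of n _ n] unfolding code_bound_def by blast

lemma code_bound_mono: "code_bound n C b P \<Longrightarrow> m \<preceq> n \<Longrightarrow> code_bound m C b P"
  unfolding code_bound_def multiple_upto_def moduli_product_def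
  using ar.less_le_trans by blast

text \<open>
  The Chinese remainder theorem. The sequence is given by a relation, from which a value is picked at
  each step, because a definable function need not be a term of the language. To adjust the solution at
  position \<open>m\<close>, with modulus \<open>d + 1\<close>, one adds a multiple \<open>Q u z\<close> of the earlier
  moduli with \<open>Q u \<equiv> 1\<close> and \<open>z = c + d a\<close>; the number \<open>d\<close> plays the role of
  \<open>-1\<close>, so that \<open>a + z \<equiv> c\<close>.
\<close>

lemma beta_solvable:
  assumes R: "definable (\<lambda>e. R (e 0) (e 1))"
    and total: "\<And>i. i \<prec> n \<Longrightarrow> \<exists>c. c \<prec> C \<and> R i c"
    and bound: "code_bound n C b P"
  shows "\<exists>a. a \<prec> P \<and> (\<forall>i. i \<prec> n \<longrightarrow> (\<exists>c. c \<prec> C \<and> R i c \<and> beta_in M a b i c))"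
proof -
  have b: "C \<preceq> b" "multiple_upto n b" and P: "moduli_product n b P"
    using bound by (auto simp: code_bound_def)
  have "\<exists>a. m \<preceq> n \<longrightarrow> (\<forall>i. i \<prec> m \<longrightarrow> (\<exists>c. c \<prec> C \<and> R i c \<and> beta_in M a b i c))" for m
  proof (rule Sigma1_induct[where n = m])
    show "definable (\<lambda>e. e 1 \<preceq> n \<longrightarrow>
        (\<forall>i. i \<prec> e 1 \<longrightarrow> (\<exists>c. c \<prec> C \<and> R i c \<and> beta_in M (e 0) b i c)))"
      by (intro definability definable_beta_in definable_subst2[OF R])
    show "\<exists>a. \<zero> \<preceq> n \<longrightarrow> (\<forall>i. i \<prec> \<zero> \<longrightarrow> (\<exists>c. c \<prec> C \<and> R i c \<and> beta_in M a b i c))"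
      by (simp add: basic)
  next
    fix m
    assume IH: "\<exists>a. m \<preceq> n \<longrightarrow> (\<forall>i. i \<prec> m \<longrightarrow> (\<exists>c. c \<prec> C \<and> R i c \<and> beta_in M a b i c))"
    show "\<exists>a. m \<oplus> \<one> \<preceq> n \<longrightarrow>
        (\<forall>i. i \<prec> m \<oplus> \<one> \<longrightarrow> (\<exists>c. c \<prec> C \<and> R i c \<and> beta_in M a b i c))"
    proof (cases "m \<oplus> \<one> \<preceq> n")
      case True
      then have m: "m \<prec> n" by (simp only: succ_leq_iff)
      with IH obtain a where a: "\<And>i. i \<prec> m \<Longrightarrow> \<exists>c. c \<prec> C \<and> R i c \<and> beta_in M a b i c"
        by (auto simp: leq_def)
      obtain Q u where Q: "moduli_product m b Q" and "beta_in M (Q \<otimes> u) b m \<one>"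
        using ex_moduli_product[OF b(2)] m by (metis ar.order_refl leq_def)
      then obtain v where v: "Q \<otimes> u = v \<otimes> modulus b m \<oplus> \<one>" by (auto simp: beta_in_iff)
      obtain c where c: "c \<prec> C" "R m c" using total[OF m] by blast
      define d where "d = (m \<oplus> \<one>) \<otimes> b"
      define z where "z = c \<oplus> d \<otimes> a"
      define a' where "a' = a \<oplus> (Q \<otimes> u) \<otimes> z"
      have d: "modulus b m = d \<oplus> \<one>" by (simp add: modulus_def d_def)
      have "a' \<oplus> \<zero> \<otimes> modulus b m = c \<oplus> (a \<oplus> v \<otimes> z) \<otimes> modulus b m"
        unfolding a'_def v z_def d by (simp add: algebra_simps)
      moreover have "beta_in M c b m c"
        using c(1) b(1) less_modulus[of b m] by (meson ar.less_le_trans ar.less_trans beta_in_less)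
      ultimately have "beta_in M a' b m c" using beta_in_cong by blast
      moreover have "beta_in M a' b i c'" if "i \<prec> m" "beta_in M a b i c'" for i c'
      proof -
        obtain q where "Q = q \<otimes> modulus b i"
          using Q \<open>i \<prec> m\<close> by (auto simp: moduli_product_def divides_def)
        then have "a' \<oplus> \<zero> \<otimes> modulus b i = a \<oplus> (q \<otimes> u \<otimes> z) \<otimes> modulus b i"
          by (simp add: a'_def ar.mult_ac)
        then show ?thesis using that(2) beta_in_cong by blast
      qed
      ultimately have "\<exists>c. c \<prec> C \<and> R i c \<and> beta_in M a' b i c" if "i \<prec> m \<oplus> \<one>" for i
        using that a c unfolding less_succ_iff leq_def by metis
      then show ?thesis by blast
    qed blast
  qed
  from this[of n] obtain a
    where a: "\<And>i. i \<prec> n \<Longrightarrow> \<exists>c. c \<prec> C \<and> R i c \<and> beta_in M a b i c"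
    by auto
  \<comment> \<open>Reduction modulo \<open>P\<close> makes the bound independent of the sequence.\<close>
  obtain q a' where a': "a' \<prec> P" "a = q \<otimes> P \<oplus> a'"
    using division P unfolding moduli_product_def by metis
  have "beta_in M a' b i c" if "i \<prec> n" "beta_in M a b i c" for i c
  proof -
    obtain p where "P = p \<otimes> modulus b i"
      using P \<open>i \<prec> n\<close> by (auto simp: moduli_product_def divides_def)
    then have "a' \<oplus> (q \<otimes> p) \<otimes> modulus b i = a \<oplus> \<zero> \<otimes> modulus b i"
      by (simp add: a'(2) ar.mult_ac ar.add_ac)
    then show ?thesis using that(2) beta_in_cong by blast
  qed
  then show ?thesis using a a'(1) by blast
qed

section \<open>Strings\<close>

lemma definable_term_pair: "definable_term s \<Longrightarrow> definable_term t \<Longrightarrow> definable_term (\<lambda>e. pair_in M (s e) (t e))"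
  unfolding pair_in_def by (intro definability)

lemma code_geq:
  "n \<preceq> pair_in M n (pair_in M a b)" "a \<preceq> pair_in M n (pair_in M a b)"
  "b \<preceq> pair_in M n (pair_in M a b)"
  by (rule pair_geq ar.order_trans[OF pair_geq(1) pair_geq(2)]
      ar.order_trans[OF pair_geq(2) pair_geq(2)])+

lemma length_in_iff:
  "length_in M s n \<longleftrightarrow> (\<exists>a. a \<preceq> s \<and> (\<exists>b. b \<preceq> s \<and> s = pair_in M n (pair_in M a b)))"
  unfolding length_in_def using code_geq by metis

lemma entry_in_iff:
  "entry_in M s i c \<longleftrightarrow> (\<exists>n. n \<preceq> s \<and> (\<exists>a. a \<preceq> s \<and> (\<exists>b. b \<preceq> s \<and>
     s = pair_in M n (pair_in M a b) \<and> i \<prec> n \<and> beta_in M a b i c)))"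
  unfolding entry_in_def using code_geq by metis

lemma definable_length_in: "definable_term s \<Longrightarrow> definable_term t \<Longrightarrow> definable (\<lambda>e. length_in M (s e) (t e))"
  unfolding length_in_iff by (intro definability definable_term_pair definable_term_shift)

lemma definable_entry_in:
  "definable_term s \<Longrightarrow> definable_term t \<Longrightarrow> definable_term u \<Longrightarrow> definable (\<lambda>e. entry_in M (s e) (t e) (u e))"
  unfolding entry_in_iff by (intro definability definable_beta_in definable_term_pair definable_term_shift)

lemma definable_entries: "definable (\<lambda>e. entry_in M s (e 0) (e 1))"
  by (intro definable_entry_in definability)

lemma length_in_code: "length_in M (pair_in M n (pair_in M a b)) m \<longleftrightarrow> m = n"
  by (auto simp: length_in_def pair_inject)

lemma entry_in_code:
  "entry_in M (pair_in M n (pair_in M a b)) i c \<longleftrightarrow> i \<prec> n \<and> beta_in M a b i c"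
  by (auto simp: entry_in_def pair_inject)

lemma length_in_unique: "length_in M s n \<Longrightarrow> length_in M s m \<Longrightarrow> n = m"
  by (auto simp: length_in_def pair_inject)

lemma entry_in_unique: "entry_in M s i c \<Longrightarrow> entry_in M s i c' \<Longrightarrow> c = c'"
  unfolding entry_in_def using beta_in_unique by (metis pair_inject)

lemma entry_in_ex: "length_in M s n \<Longrightarrow> i \<prec> n \<Longrightarrow> \<exists>c. entry_in M s i c"
  using beta_in_ex by (auto simp: length_in_def entry_in_code)

lemma entry_in_less_length: "entry_in M s i c \<Longrightarrow> length_in M s n \<Longrightarrow> i \<prec> n"
  by (auto simp: length_in_def entry_in_code)

lemma entry_in_leq: "entry_in M s i c \<Longrightarrow> c \<preceq> s"
proof -
  assume "entry_in M s i c"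
  then obtain n a b q where s: "s = pair_in M n (pair_in M a b)" "a = q \<otimes> modulus b i \<oplus> c"
    by (auto simp: entry_in_def beta_in_iff)
  have "c \<preceq> a" by (simp add: s(2))
  also have "\<dots> \<preceq> s" unfolding s(1) by (rule code_geq)
  finally show ?thesis .
qed

lemma length_in_leq: "length_in M s n \<Longrightarrow> n \<preceq> s"
  using pair_geq by (auto simp: length_in_def)

text \<open>
  This form, in which all quantifiers are bounded, makes it possible to search for the least code of a
  string.
\<close>

lemma same_string_iff:
  assumes "length_in M s n"
  shows "same_string M t s \<longleftrightarrow> length_in M t n \<and>
    (\<forall>i. i \<prec> n \<longrightarrow> (\<exists>c. c \<preceq> s \<and> entry_in M t i c \<and> entry_in M s i c))"
proof
  assume *: "same_string M t s"
  then have "length_in M t n"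
    using assms length_in_unique unfolding same_string_def by blast
  moreover have "\<exists>c. c \<preceq> s \<and> entry_in M t i c \<and> entry_in M s i c" if "i \<prec> n" for i
    using entry_in_ex[OF assms that] entry_in_leq * unfolding same_string_def by blast
  ultimately show "length_in M t n \<and>
    (\<forall>i. i \<prec> n \<longrightarrow> (\<exists>c. c \<preceq> s \<and> entry_in M t i c \<and> entry_in M s i c))" by blast
next
  assume "length_in M t n \<and>
    (\<forall>i. i \<prec> n \<longrightarrow> (\<exists>c. c \<preceq> s \<and> entry_in M t i c \<and> entry_in M s i c))"
  then show "same_string M t s"
    unfolding same_string_def using assms entry_in_less_length entry_in_unique by metis
qed

lemma ex_least_code:
  assumes "length_in M s n"
  shows "\<exists>t. t \<preceq> s \<and> is_string M t \<and> same_string M t s"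
proof -
  have "definable (\<lambda>e. length_in M (e 0) n \<and>
      (\<forall>i. i \<prec> n \<longrightarrow> (\<exists>c. c \<preceq> s \<and> entry_in M (e 0) i c \<and> entry_in M s i c)))"
    by (intro definability definable_length_in definable_entry_in)
  then have "definable (\<lambda>e. same_string M (e 0) s)"
    by (simp only: same_string_iff[OF assms])
  moreover have "same_string M s s" using assms by (auto simp: same_string_def)
  ultimately obtain t where t: "same_string M t s" "t \<preceq> s" "\<And>x. x \<prec> t \<Longrightarrow> \<not> same_string M x s"
    using least_number[where P = "\<lambda>t. same_string M t s"] by blast
  have "\<not> same_string M x t" if "x \<prec> t" for x
    using t(1) t(3)[OF that] length_in_unique unfolding same_string_def by metis
  moreover have "\<exists>n. length_in M t n" using t(1) by (auto simp: same_string_def)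
  ultimately show ?thesis using t(1,2) by (auto simp: is_string_def)
qed

lemma string_eqI:
  assumes "is_string M s" "is_string M t" "length_in M s n" "length_in M t n"
    and "\<And>i c. entry_in M s i c \<longleftrightarrow> entry_in M t i c"
  shows "s = t"
proof -
  have "same_string M s t" "same_string M t s"
    using assms(3-) by (auto simp: same_string_def)
  then show ?thesis
    using assms(1,2) less_trichotomy unfolding is_string_def by metis
qed

lemma strings_over_entry:
  "s \<in> strings_over M k \<Longrightarrow> length_in M s n \<Longrightarrow> i \<prec> n \<Longrightarrow>
    \<exists>c. c \<prec> numeral_in M k \<and> entry_in M s i c"
  using entry_in_ex by (fastforce simp: strings_over_def)

lemma ex_string:
  assumes R: "definable (\<lambda>e. R (e 0) (e 1))"
    and total: "\<And>i. i \<prec> n \<Longrightarrow> \<exists>c. c \<prec> C \<and> R i c"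
    and bound: "code_bound n C b P"
  shows "\<exists>s. s \<preceq> pair_in M n (pair_in M P b) \<and> is_string M s \<and> length_in M s n \<and>
    (\<forall>i. i \<prec> n \<longrightarrow> (\<exists>c. c \<prec> C \<and> R i c \<and> entry_in M s i c))"
proof -
  obtain a where a: "a \<prec> P" "\<And>i. i \<prec> n \<Longrightarrow> \<exists>c. c \<prec> C \<and> R i c \<and> beta_in M a b i c"
    using beta_solvable[OF assms] by blast
  let ?s = "pair_in M n (pair_in M a b)"
  obtain t where t: "t \<preceq> ?s" "is_string M t" "same_string M t ?s"
    using ex_least_code[of ?s n] by (auto simp: length_in_code)
  have "?s \<preceq> pair_in M n (pair_in M P b)"
    by (intro pair_mono ar.order_refl ar.less_imp_le a(1))
  moreover have "length_in M t n" "\<And>i c. entry_in M t i c \<longleftrightarrow> i \<prec> n \<and> beta_in M a b i c"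
    using t(3) by (auto simp: same_string_def length_in_code entry_in_code)
  ultimately show ?thesis
    using t a(2) ar.order_trans by (intro exI[of _ t]) blast
qed

text \<open>
  A number that bounds all codes of strings of length at most \<open>n\<close> with entries below
  \<open>C\<close>, certified by its components. That all codes are below a given number is a
  \<open>\<Pi>\<^sub>1\<close> statement; the certificate replaces it by a bounded one, which is what
  \<open>\<Delta>\<^sub>1\<close> comprehension requires.
\<close>

definition bounds_codes :: "'a \<Rightarrow> 'a \<Rightarrow> 'a \<Rightarrow> bool" where
  "bounds_codes C n B \<longleftrightarrow> (\<exists>b. b \<preceq> B \<and> (\<exists>P. P \<preceq> B \<and>
     B = pair_in M n (pair_in M P b) \<and> code_bound n C b P))"

lemma definable_bounds_codes:
  "definable_term s \<Longrightarrow> definable_term t \<Longrightarrow> definable_term u \<Longrightarrow> definable (\<lambda>e. bounds_codes (s e) (t e) (u e))"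
  unfolding bounds_codes_def by (intro definability definable_code_bound definable_term_pair definable_term_shift)

lemma ex_bounds_codes: "\<exists>B. bounds_codes C n B"
  using ex_code_bound[of n C] code_geq unfolding bounds_codes_def by metis

lemma length_leq_bound: "bounds_codes C n B \<Longrightarrow> n \<preceq> B"
  using pair_geq unfolding bounds_codes_def by blast

text \<open>
  A string is the unique one with its entries, hence it coincides with the string of small code that
  the Chinese remainder theorem provides for these entries.
\<close>

lemma code_leq_bound:
  assumes B: "bounds_codes (numeral_in M k) n B"
    and s: "s \<in> strings_over M k" "length_in M s m" and "m \<preceq> n"
  shows "s \<preceq> B"
proof -
  obtain b P where B_eq: "B = pair_in M n (pair_in M P b)"
    and bound: "code_bound n (numeral_in M k) b P"
    using B by (auto simp: bounds_codes_def)
  have "\<exists>c. c \<prec> numeral_in M k \<and> entry_in M s i c" if "i \<prec> m" for i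
    by (rule strings_over_entry[OF s that])
  then obtain t where t: "t \<preceq> pair_in M m (pair_in M P b)" "is_string M t" "length_in M t m"
      "\<And>i. i \<prec> m \<Longrightarrow> \<exists>c. entry_in M s i c \<and> entry_in M t i c"
    using ex_string[of "entry_in M s", OF definable_entries _ code_bound_mono[OF bound \<open>m \<preceq> n\<close>]]
    by blast
  have "entry_in M s i c \<longleftrightarrow> entry_in M t i c" for i c
    using t(3,4) s(2) entry_in_less_length entry_in_unique by metis
  then have "s = t" using string_eqI s t by (auto simp: strings_over_def)
  then show ?thesis
    using t(1) pair_mono[OF \<open>m \<preceq> n\<close> ar.order_refl] ar.order_trans unfolding B_eq by blast
qed

lemma ex_string_over:
  assumes R: "definable (\<lambda>e. R (e 0) (e 1))"
    and total: "\<And>i. i \<prec> n \<Longrightarrow> \<exists>c. c \<prec> numeral_in M k \<and> R i c"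
  shows "\<exists>s\<in>strings_over M k. length_in M s n \<and> (\<forall>i c. entry_in M s i c \<longrightarrow> R i c)"
proof -
  obtain s where s: "is_string M s" "length_in M s n"
      "\<And>i. i \<prec> n \<Longrightarrow> \<exists>c. c \<prec> numeral_in M k \<and> R i c \<and> entry_in M s i c"
    using ex_string[OF R total] ex_code_bound by metis
  have "c \<prec> numeral_in M k \<and> R i c" if "entry_in M s i c" for i c
    using s(3)[OF entry_in_less_length[OF that s(2)]] that entry_in_unique by blast
  then show ?thesis using s(1,2) by (auto simp: strings_over_def)
qed

lemma ex_restriction:
  assumes s: "s \<in> strings_over M k" "length_in M s n" and "m \<preceq> n"
  shows "\<exists>t\<in>strings_over M k. length_in M t m \<and> initial_segment M t s"
proof -
  have "\<exists>c. c \<prec> numeral_in M k \<and> entry_in M s i c" if "i \<prec> m" for i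
    using strings_over_entry[OF s ar.less_le_trans[OF that \<open>m \<preceq> n\<close>]] .
  then obtain t where "t \<in> strings_over M k" "length_in M t m"
      "\<forall>i c. entry_in M t i c \<longrightarrow> entry_in M s i c"
    using ex_string_over[of "entry_in M s", OF definable_entries] by blast
  then show ?thesis
    using s(2) \<open>m \<preceq> n\<close> by (auto simp: initial_segment_def leq_def)
qed

lemma tree_restriction:
  assumes T: "tree_in M k T" and s: "s \<in> T" "length_in M s n" and "m \<preceq> n"
  obtains t where "t \<in> T" "length_in M t m" "\<And>i c. entry_in M t i c \<Longrightarrow> entry_in M s i c"
proof -
  have "s \<in> strings_over M k" using T s(1) by (auto simp: tree_in_def)
  then obtain t where t: "t \<in> strings_over M k" "length_in M t m" "initial_segment M t s"
    using ex_restriction s(2) \<open>m \<preceq> n\<close> by blast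
  then have "t \<in> T" using T s(1) by (auto simp: tree_in_def strings_over_def)
  then show ?thesis using t that by (auto simp: initial_segment_def)
qed

text \<open>
  Infinite sets of strings are unbounded only as sets of codes. Strings of bounded length have bounded
  codes, so their lengths are unbounded as well.
\<close>

lemma long_strings:
  assumes A: "A \<subseteq> strings_over M k" "infinite_in M A"
  obtains s m where "s \<in> A" "length_in M s m" "n \<prec> m"
proof -
  obtain B where B: "bounds_codes (numeral_in M k) n B" using ex_bounds_codes by blast
  obtain s where s: "s \<in> A" "B \<prec> s" using A(2) by (auto simp: infinite_in_def)
  obtain m where m: "length_in M s m"
    using s(1) A(1) by (auto simp: strings_over_def is_string_def)
  have "\<not> m \<preceq> n"
    using code_leq_bound[OF B _ m] s A(1) ar.not_le by blast
  then show ?thesis using that s(1) m ar.not_le by blast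
qed

lemma infinite_of_lengths:
  assumes "\<And>n. \<exists>s\<in>A. \<exists>m. length_in M s m \<and> n \<prec> m"
  shows "infinite_in M A"
  unfolding infinite_in_def using assms length_in_leq ar.less_le_trans by meson

lemma definable_same_string: "definable_term s \<Longrightarrow> definable_term t \<Longrightarrow> definable (\<lambda>e. same_string M (s e) (t e))"
proof -
  have "same_string M t s \<longleftrightarrow> (\<exists>n. n \<preceq> s \<and> length_in M s n \<and> length_in M t n \<and>
      (\<forall>i. i \<prec> n \<longrightarrow> (\<exists>c. c \<preceq> s \<and> entry_in M t i c \<and> entry_in M s i c)))" for s t
  proof (cases "\<exists>n. length_in M s n")
    case True
    then obtain n where "length_in M s n" by blast
    then show ?thesis using same_string_iff length_in_unique length_in_leq by metis
  qed (auto simp: same_string_def)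
  then show "definable_term s \<Longrightarrow> definable_term t \<Longrightarrow> definable (\<lambda>e. same_string M (s e) (t e))"
    by (simp only:) (intro definability definable_length_in definable_entry_in definable_term_shift)
qed

lemma definable_is_string: "definable_term s \<Longrightarrow> definable (\<lambda>e. is_string M (s e))"
proof -
  have "is_string M s \<longleftrightarrow> (\<exists>n. n \<preceq> s \<and> length_in M s n) \<and> \<not> (\<exists>t. t \<prec> s \<and> same_string M t s)" for s
    using length_in_leq unfolding is_string_def by blast
  then show "definable_term s \<Longrightarrow> definable (\<lambda>e. is_string M (s e))"
    by (simp only:) (intro definability definable_length_in definable_same_string definable_term_shift)
qed

lemma entry_in_position_leq: "entry_in M s i c \<Longrightarrow> i \<preceq> s"
  unfolding entry_in_def using code_geq(1) ar.less_imp_le ar.order_trans by metis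

lemma strings_over_set: "strings_over M k \<in> Sets M"
proof -
  have "s \<in> strings_over M k \<longleftrightarrow> is_string M s \<and>
      (\<forall>i. i \<preceq> s \<longrightarrow> (\<forall>c. c \<preceq> s \<longrightarrow> entry_in M s i c \<longrightarrow> c \<prec> numeral_in M k))" for s
    using entry_in_leq entry_in_position_leq unfolding strings_over_def by blast
  moreover have "definable (\<lambda>e. is_string M (e 0) \<and>
      (\<forall>i. i \<preceq> e 0 \<longrightarrow> (\<forall>c. c \<preceq> e 0 \<longrightarrow> entry_in M (e 0) i c \<longrightarrow> c \<prec> numeral_in M k)))"
    by (intro definability definable_is_string definable_entry_in definable_term_shift)
  ultimately have "definable (\<lambda>e. e 0 \<in> strings_over M k)" by (simp only:)
  from bounded_set[where P = "\<lambda>s. s \<in> strings_over M k", OF this] show ?thesis by simp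
qed

section \<open>Recolouring a tree along an infinite set\<close>

definition next_element :: "'a set \<Rightarrow> 'a \<Rightarrow> 'a \<Rightarrow> bool" where
  "next_element X i x \<longleftrightarrow> x \<in> X \<and> i \<preceq> x \<and> (\<forall>y. y \<prec> x \<longrightarrow> y \<in> X \<longrightarrow> y \<prec> i)"

lemma definable_next_element:
  "X \<in> Sets M \<Longrightarrow> definable_term s \<Longrightarrow> definable_term t \<Longrightarrow> definable (\<lambda>e. next_element X (s e) (t e))"
  unfolding next_element_def by (intro definability definable_term_shift)

lemma next_element_leq: "next_element X i x \<Longrightarrow> y \<in> X \<Longrightarrow> i \<preceq> y \<Longrightarrow> x \<preceq> y"
  unfolding next_element_def using ar.not_le by blast

lemma next_element_unique: "next_element X i x \<Longrightarrow> next_element X i x' \<Longrightarrow> x = x'"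
  using next_element_leq ar.order_antisym unfolding next_element_def by metis

lemma ex_next_element:
  assumes "X \<in> Sets M" "infinite_in M X"
  shows "\<exists>x. next_element X i x"
proof -
  have *: "definable (\<lambda>e. e 0 \<in> X \<and> i \<preceq> e 0)" by (intro definability assms)
  obtain x where "x \<in> X" "i \<prec> x" using assms(2) by (auto simp: infinite_in_def)
  then show ?thesis
    using least_number[where P = "\<lambda>x. x \<in> X \<and> i \<preceq> x", OF *, of x] ar.not_le
    unfolding next_element_def by (auto simp: ar.less_imp_le)
qed

text \<open>
  The string \<open>\<sigma>\<close> lists at position \<open>i\<close> a new colour of the colour that \<open>\<tau>\<close> has
  at the least element of \<open>X\<close> from \<open>i\<close> on.
\<close>

definition projects :: "'a set \<Rightarrow> ('a \<Rightarrow> 'a \<Rightarrow> bool) \<Rightarrow> 'a \<Rightarrow> 'a \<Rightarrow> bool" where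
  "projects X R \<tau> \<sigma> \<longleftrightarrow> (\<exists>n. length_in M \<sigma> n \<and> (\<forall>i. i \<prec> n \<longrightarrow>
     (\<exists>x c c'. next_element X i x \<and> entry_in M \<tau> x c \<and> entry_in M \<sigma> i c' \<and> R c c')))"

lemma projectsD:
  "projects X R \<tau> \<sigma> \<Longrightarrow> length_in M \<sigma> n \<Longrightarrow> i \<prec> n \<Longrightarrow>
    \<exists>x c c'. next_element X i x \<and> entry_in M \<tau> x c \<and> entry_in M \<sigma> i c' \<and> R c c'"
  unfolding projects_def using length_in_unique by blast

lemma definable_projects:
  assumes "X \<in> Sets M" "definable (\<lambda>e. R (e 0) (e 1))" "definable_term s" "definable_term t"
  shows "definable (\<lambda>e. projects X R (s e) (t e))"
proof -
  have "projects X R \<tau> \<sigma> \<longleftrightarrow> (\<exists>n. n \<preceq> \<sigma> \<and> (length_in M \<sigma> n \<and> (\<forall>i. i \<prec> n \<longrightarrow>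
      (\<exists>x. x \<preceq> \<tau> \<and> (\<exists>c. c \<preceq> \<tau> \<and> (\<exists>c'. c' \<preceq> \<sigma> \<and> (next_element X i x \<and> entry_in M \<tau> x c \<and>
        entry_in M \<sigma> i c' \<and> R c c')))))))" for \<tau> \<sigma>
    unfolding projects_def
    using length_in_leq entry_in_leq entry_in_position_leq by meson
  then show ?thesis
    by (simp only:) (intro definability definable_length_in definable_entry_in definable_next_element
      definable_subst2[OF assms(2)] assms(1,3,4) definable_term_shift)
qed

lemma projects_length_leq:
  assumes "projects X R \<tau> \<sigma>" "length_in M \<tau> m" "length_in M \<sigma> n"
  shows "n \<preceq> m"
proof (rule ccontr)
  assume "\<not> n \<preceq> m"
  then have "m \<prec> n" using ar.not_le by blast
  then obtain x c where "next_element X m x" "entry_in M \<tau> x c"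
    using projectsD[OF assms(1,3)] by blast
  then have "m \<preceq> x" "x \<prec> m"
    using assms(2) entry_in_less_length by (auto simp: next_element_def)
  then show False using ar.not_le by blast
qed

text \<open>
  If \<open>y\<close> is any element of \<open>X\<close> that is at least \<open>|\<sigma>|\<close>, all relevant positions of
  \<open>\<tau>\<close> are at most \<open>y\<close>. A witness \<open>\<tau>\<close> can therefore be cut down to any
  length \<open>N > y\<close>, and the search for it may be restricted to the codes below any bound for the
  strings of length \<open>N\<close>. This turns the existential definition into a universal one.
\<close>

lemma projection_tree_set:
  assumes T: "tree_in M k T" and X: "X \<in> Sets M" "infinite_in M X"
    and R: "definable (\<lambda>e. R (e 0) (e 1))"
  shows "{\<sigma> \<in> strings_over M l. \<exists>\<tau>\<in>T. projects X R \<tau> \<sigma>} \<in> Sets M"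
proof -
  have T_set: "T \<in> Sets M" and T_sub: "T \<subseteq> strings_over M k" using T by (auto simp: tree_in_def)
  let ?P = "\<lambda>\<tau> \<sigma>. \<sigma> \<in> strings_over M l \<and> \<tau> \<in> T \<and> projects X R \<tau> \<sigma>"
  let ?Q = "\<lambda>B \<sigma>. \<sigma> \<in> strings_over M l \<and> (\<forall>N. N \<preceq> B \<longrightarrow>
    bounds_codes (numeral_in M k) N B \<longrightarrow>
    (\<exists>n. n \<preceq> \<sigma> \<and> (length_in M \<sigma> n \<and> (\<exists>x. x \<prec> N \<and> (x \<in> X \<and> n \<preceq> x)))) \<longrightarrow>
    (\<exists>\<tau>. \<tau> \<preceq> B \<and> (\<tau> \<in> T \<and> projects X R \<tau> \<sigma>)))"
  have "definable (\<lambda>e. ?P (e 0) (e 1))"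
    by (intro definability definable_projects strings_over_set T_set X R)
  moreover have "definable (\<lambda>e. ?Q (e 0) (e 1))"
    by (intro definability definable_projects definable_bounds_codes definable_length_in strings_over_set T_set X R)
  moreover have "(\<exists>\<tau>. ?P \<tau> \<sigma>) \<longleftrightarrow> (\<forall>B. ?Q B \<sigma>)" for \<sigma>
  proof
    assume "\<exists>\<tau>. ?P \<tau> \<sigma>"
    then obtain \<tau> where \<sigma>: "\<sigma> \<in> strings_over M l" and \<tau>: "\<tau> \<in> T" "projects X R \<tau> \<sigma>" by blast
    have "\<exists>\<tau>'. \<tau>' \<preceq> B \<and> (\<tau>' \<in> T \<and> projects X R \<tau>' \<sigma>)"
      if B: "bounds_codes (numeral_in M k) N B"
        and n: "length_in M \<sigma> n" and y: "y \<prec> N" "y \<in> X" "n \<preceq> y" for B N n y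
    proof -
      obtain m where m: "length_in M \<tau> m"
        using \<tau>(1) T_sub by (auto simp: strings_over_def is_string_def)
      show ?thesis
      proof (cases "m \<preceq> N")
        case True
        then show ?thesis using code_leq_bound[OF B _ m] \<tau> T_sub by blast
      next
        case False
        then have "N \<preceq> m" using ar.le_cases by blast
        then obtain \<tau>' where \<tau>': "\<tau>' \<in> T" "length_in M \<tau>' N"
            "\<And>i c. entry_in M \<tau>' i c \<Longrightarrow> entry_in M \<tau> i c"
          using tree_restriction[OF T \<tau>(1) m] by metis
        have "\<exists>x c c'. next_element X i x \<and> entry_in M \<tau>' x c \<and> entry_in M \<sigma> i c' \<and> R c c'"
          if i: "i \<prec> n" for i
        proof -
          obtain x c c' where x: "next_element X i x" "entry_in M \<tau> x c" "entry_in M \<sigma> i c'" "R c c'"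
            using projectsD[OF \<tau>(2) n i] by blast
          have "x \<preceq> y"
            using next_element_leq[OF x(1) y(2)] i y(3) ar.less_imp_le ar.order_trans by blast
          then have "x \<prec> N" using y(1) ar.le_less_trans by blast
          then obtain c'' where "entry_in M \<tau>' x c''" using entry_in_ex[OF \<tau>'(2)] by blast
          then show ?thesis using x \<tau>'(3) entry_in_unique by metis
        qed
        then have "projects X R \<tau>' \<sigma>" unfolding projects_def using n by blast
        then show ?thesis
          using code_leq_bound[OF B _ \<tau>'(2) ar.order_refl] \<tau>'(1) T_sub by blast
      qed
    qed
    then show "\<forall>B. ?Q B \<sigma>" using \<sigma> by blast
  next
    assume Q: "\<forall>B. ?Q B \<sigma>"
    then have \<sigma>: "\<sigma> \<in> strings_over M l" by blast
    then obtain n where n: "length_in M \<sigma> n" by (auto simp: strings_over_def is_string_def)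
    obtain x where x: "x \<in> X" "n \<prec> x" using X(2) by (auto simp: infinite_in_def)
    obtain B where B: "bounds_codes (numeral_in M k) (x \<oplus> \<one>) B" using ex_bounds_codes by blast
    have "x \<prec> x \<oplus> \<one>" by (simp add: less_succ_iff)
    then have "\<exists>\<tau>. \<tau> \<preceq> B \<and> (\<tau> \<in> T \<and> projects X R \<tau> \<sigma>)"
      using Q B length_leq_bound[OF B] length_in_leq[OF n] n x ar.less_imp_le by blast
    then show "\<exists>\<tau>. ?P \<tau> \<sigma>" using \<sigma> by blast
  qed
  ultimately have "{\<sigma>. \<exists>\<tau>. ?P \<tau> \<sigma>} \<in> Sets M" by (rule Delta1_set)
  moreover have "{\<sigma>. \<exists>\<tau>. ?P \<tau> \<sigma>} = {\<sigma> \<in> strings_over M l. \<exists>\<tau>\<in>T. projects X R \<tau> \<sigma>}" by blast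
  ultimately show ?thesis by simp
qed

lemma projection_tree:
  assumes T: "tree_in M k T" and X: "X \<in> Sets M" "infinite_in M X"
    and R: "definable (\<lambda>e. R (e 0) (e 1))"
  shows "tree_in M l {\<sigma> \<in> strings_over M l. \<exists>\<tau>\<in>T. projects X R \<tau> \<sigma>}"
  unfolding tree_in_def
proof (intro conjI ballI allI impI)
  fix \<sigma> \<sigma>'
  assume "\<sigma> \<in> {\<sigma> \<in> strings_over M l. \<exists>\<tau>\<in>T. projects X R \<tau> \<sigma>}"
  then obtain \<tau> where \<sigma>: "\<sigma> \<in> strings_over M l" and \<tau>: "\<tau> \<in> T" "projects X R \<tau> \<sigma>" by blast
  assume "is_string M \<sigma>' \<and> initial_segment M \<sigma>' \<sigma>"
  then obtain m n where \<sigma>': "is_string M \<sigma>'" "length_in M \<sigma>' m" "length_in M \<sigma> n" "m \<preceq> n"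
      "\<And>i c. entry_in M \<sigma>' i c \<Longrightarrow> entry_in M \<sigma> i c"
    unfolding initial_segment_def leq_def by blast
  have "\<exists>x c c'. next_element X i x \<and> entry_in M \<tau> x c \<and> entry_in M \<sigma>' i c' \<and> R c c'"
    if "i \<prec> m" for i
    using projectsD[OF \<tau>(2) \<sigma>'(3) ar.less_le_trans[OF that \<sigma>'(4)]]
      entry_in_ex[OF \<sigma>'(2) that] \<sigma>'(5) entry_in_unique by metis
  then have "projects X R \<tau> \<sigma>'" unfolding projects_def using \<sigma>'(2) by blast
  moreover have "\<sigma>' \<in> strings_over M l" using \<sigma> \<sigma>'(1,5) unfolding strings_over_def by blast
  ultimately show "\<sigma>' \<in> {\<sigma> \<in> strings_over M l. \<exists>\<tau>\<in>T. projects X R \<tau> \<sigma>}"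
    using \<tau>(1) by blast
qed (use projection_tree_set[OF assms] in auto)

text \<open>
  Projecting one sufficiently long string of \<open>T\<close> yields a string of any prescribed length; the
  string over the new colours exists by the Chinese remainder theorem.
\<close>

lemma projection_tree_infinite:
  assumes T: "tree_in M k T" "infinite_in M T" and X: "X \<in> Sets M" "infinite_in M X"
    and R: "definable (\<lambda>e. R (e 0) (e 1))"
    and recolour: "\<And>\<tau> x c. \<tau> \<in> T \<Longrightarrow> x \<in> X \<Longrightarrow> entry_in M \<tau> x c \<Longrightarrow>
      \<exists>c'. c' \<prec> numeral_in M l \<and> R c c'"
  shows "infinite_in M {\<sigma> \<in> strings_over M l. \<exists>\<tau>\<in>T. projects X R \<tau> \<sigma>}"
proof (rule infinite_of_lengths)
  fix n
  obtain y where y: "y \<in> X" "n \<prec> y" using X(2) by (auto simp: infinite_in_def)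
  obtain \<tau> m where \<tau>: "\<tau> \<in> T" "length_in M \<tau> m" "y \<prec> m"
    using long_strings[OF _ T(2)] T(1) unfolding tree_in_def by metis
  let ?R = "\<lambda>i c'. \<exists>x. x \<preceq> \<tau> \<and> (\<exists>c. c \<preceq> \<tau> \<and> (next_element X i x \<and> entry_in M \<tau> x c \<and> R c c'))"
  have "definable (\<lambda>e. ?R (e 0) (e 1))"
    by (intro definability definable_next_element definable_entry_in definable_subst2[OF R] X)
  moreover have "\<exists>c'. c' \<prec> numeral_in M l \<and> ?R i c'" if i: "i \<prec> n \<oplus> \<one>" for i
  proof -
    obtain x where x: "next_element X i x" using ex_next_element[OF X] by blast
    have "i \<preceq> y" using i y(2) ar.less_imp_le ar.order_trans unfolding less_succ_iff by blast
    then have "x \<prec> m"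
      using next_element_leq[OF x y(1)] \<tau>(3) ar.le_less_trans by blast
    then obtain c where c: "entry_in M \<tau> x c" using entry_in_ex[OF \<tau>(2)] by blast
    then obtain c' where "c' \<prec> numeral_in M l" "R c c'"
      using recolour[OF \<tau>(1) _ c] x by (auto simp: next_element_def)
    then show ?thesis using x c entry_in_leq entry_in_position_leq by blast
  qed
  ultimately obtain \<sigma> where \<sigma>: "\<sigma> \<in> strings_over M l" "length_in M \<sigma> (n \<oplus> \<one>)"
      "\<And>i c'. entry_in M \<sigma> i c' \<Longrightarrow> ?R i c'"
    using ex_string_over[of ?R "n \<oplus> \<one>" l] by blast
  have "\<exists>x c c'. next_element X i x \<and> entry_in M \<tau> x c \<and> entry_in M \<sigma> i c' \<and> R c c'"
    if "i \<prec> n \<oplus> \<one>" for i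
    using entry_in_ex[OF \<sigma>(2) that] \<sigma>(3) by metis
  then have "projects X R \<tau> \<sigma>"
    unfolding projects_def using \<sigma>(2) by blast
  moreover have "n \<prec> n \<oplus> \<one>" by (simp add: less_succ_iff)
  ultimately show "\<exists>\<sigma>\<in>{\<sigma> \<in> strings_over M l. \<exists>\<tau>\<in>T. projects X R \<tau> \<sigma>}.
      \<exists>m. length_in M \<sigma> m \<and> n \<prec> m"
    using \<sigma>(1,2) \<tau>(1) by blast
qed

text \<open>
  The set \<open>H\<close> is the image of a homogeneous set \<open>G\<close> for the projected tree under the map to
  the next element of \<open>X\<close>. If \<open>\<tau>\<close> projects to a homogeneous \<open>\<sigma>\<close>, its colours
  are controlled only at positions \<open>f(i)\<close> with \<open>i < |\<sigma>|\<close>. After restricting \<open>\<tau>\<close>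
  to the length of \<open>\<sigma>\<close> these are all positions in \<open>H\<close>, because \<open>i \<le> f(i)\<close>.
\<close>

lemma RWKL_recolour:
  assumes RWKL: "RWKL_k M l"
    and T: "tree_in M k T" "infinite_in M T" and X: "X \<in> Sets M" "infinite_in M X"
    and R: "definable (\<lambda>e. R (e 0) (e 1))"
    and recolour: "\<And>\<tau> x c. \<tau> \<in> T \<Longrightarrow> x \<in> X \<Longrightarrow> entry_in M \<tau> x c \<Longrightarrow>
      \<exists>c'. c' \<prec> numeral_in M l \<and> R c c'"
  shows "\<exists>H\<in>Sets M. H \<subseteq> X \<and> infinite_in M H \<and>
    infinite_in M {\<tau> \<in> T. \<exists>c'. c' \<prec> numeral_in M l \<and> (\<forall>x\<in>H. \<forall>c. entry_in M \<tau> x c \<longrightarrow> R c c')}"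
proof -
  let ?S = "{\<sigma> \<in> strings_over M l. \<exists>\<tau>\<in>T. projects X R \<tau> \<sigma>}"
  have "tree_in M l ?S" by (rule projection_tree[OF T(1) X R])
  moreover have "infinite_in M ?S" by (rule projection_tree_infinite[OF T X R recolour])
  ultimately obtain G where G: "G \<in> Sets M" "infinite_in M G" and "homogeneous_tree M l G ?S"
    using RWKL[unfolded RWKL_k_def, rule_format, of ?S] by metis
  then have S: "infinite_in M {\<sigma> \<in> ?S. homogeneous_string M l G \<sigma>}"
    by (simp only: homogeneous_tree_def)
  define H where "H = {x. x \<in> X \<and> (\<exists>i. i \<preceq> x \<and> (i \<in> G \<and> next_element X i x))}"
  have "definable (\<lambda>e. e 0 \<in> X \<and> (\<exists>i. i \<preceq> e 0 \<and> (i \<in> G \<and> next_element X i (e 0))))"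
    by (intro definability definable_next_element X G)
  then have "H \<in> Sets M" unfolding H_def by (rule bounded_set)
  moreover have "H \<subseteq> X" by (auto simp: H_def)
  moreover have "infinite_in M H"
    unfolding infinite_in_def
  proof
    fix n
    obtain i where i: "i \<in> G" "n \<prec> i" using G(2) by (auto simp: infinite_in_def)
    obtain x where x: "next_element X i x" using ex_next_element[OF X] by blast
    then have "x \<in> X" "i \<preceq> x" by (auto simp: next_element_def)
    then show "\<exists>x\<in>H. n \<prec> x" using i x ar.less_le_trans unfolding H_def by blast
  qed
  moreover have "infinite_in M
    {\<tau> \<in> T. \<exists>c'. c' \<prec> numeral_in M l \<and> (\<forall>x\<in>H. \<forall>c. entry_in M \<tau> x c \<longrightarrow> R c c')}"
  proof (rule infinite_of_lengths)
    fix n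
    obtain \<sigma> m where \<sigma>: "\<sigma> \<in> ?S" "homogeneous_string M l G \<sigma>" and m: "length_in M \<sigma> m" "n \<prec> m"
      using long_strings[OF _ S, of l n] by blast
    obtain \<tau> where \<tau>: "\<tau> \<in> T" "projects X R \<tau> \<sigma>" using \<sigma>(1) by blast
    obtain c' where c': "c' \<prec> numeral_in M l" "\<And>i. i \<in> G \<Longrightarrow> i \<prec> m \<Longrightarrow> entry_in M \<sigma> i c'"
      using \<sigma>(2) m(1) unfolding homogeneous_string_def by blast
    obtain m' where m': "length_in M \<tau> m'"
      using \<tau>(1) T(1) by (auto simp: tree_in_def strings_over_def is_string_def)
    obtain \<tau>' where \<tau>': "\<tau>' \<in> T" "length_in M \<tau>' m"
        "\<And>i c. entry_in M \<tau>' i c \<Longrightarrow> entry_in M \<tau> i c"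
      using tree_restriction[OF T(1) \<tau>(1) m' projects_length_leq[OF \<tau>(2) m' m(1)]] by metis
    have "R c c'" if x: "x \<in> H" "entry_in M \<tau>' x c" for x c
    proof -
      obtain i where i: "i \<preceq> x" "i \<in> G" "next_element X i x" using x(1) by (auto simp: H_def)
      have "i \<prec> m"
        using entry_in_less_length[OF x(2) \<tau>'(2)] i(1) ar.le_less_trans by blast
      then show ?thesis
        using projectsD[OF \<tau>(2) m(1)] c'(2)[OF i(2)] \<tau>'(3)[OF x(2)] i(3)
          next_element_unique entry_in_unique by metis
    qed
    then show "\<exists>\<tau>\<in>{\<tau> \<in> T. \<exists>c'. c' \<prec> numeral_in M l \<and>
        (\<forall>x\<in>H. \<forall>c. entry_in M \<tau> x c \<longrightarrow> R c c')}. \<exists>m. length_in M \<tau> m \<and> n \<prec> m"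
      using \<tau>'(1,2) c'(1) m(2) by blast
  qed
  ultimately show ?thesis by (intro bexI[of _ H] conjI)
qed

section \<open>Equivalence of the principles\<close>

lemma infinite_in_mono: "infinite_in M A \<Longrightarrow> A \<subseteq> B \<Longrightarrow> infinite_in M B"
  unfolding infinite_in_def by blast

lemma infinite_in_Un: "infinite_in M (A \<union> B) \<Longrightarrow> infinite_in M A \<or> infinite_in M B"
proof (rule ccontr)
  assume AB: "infinite_in M (A \<union> B)" and "\<not> (infinite_in M A \<or> infinite_in M B)"
  then obtain a b where a: "\<And>x. x \<in> A \<Longrightarrow> \<not> a \<prec> x" and b: "\<And>x. x \<in> B \<Longrightarrow> \<not> b \<prec> x"
    unfolding infinite_in_def by blast
  obtain x where "x \<in> A \<union> B" "a \<oplus> b \<prec> x" using AB by (auto simp: infinite_in_def)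
  then show False
    using a b leq_plus ar.le_less_trans by blast
qed

lemma homogeneous_stringI:
  assumes "c \<prec> numeral_in M k" "\<And>i c'. i \<in> H \<Longrightarrow> entry_in M s i c' \<Longrightarrow> c' = c"
  shows "homogeneous_string M k H s"
  unfolding homogeneous_string_def using assms entry_in_ex by metis

lemma definable_equality: "definable (\<lambda>e. e 0 = e 1)"
  by (intro definability)

lemma RWKL_imp_LRWKL: assumes "RWKL_k M k" shows "LRWKL_k M k"
  unfolding LRWKL_k_def
proof (intro allI ballI impI, elim conjE)
  fix T X assume *: "tree_in M k T" "infinite_in M T" "X \<in> Sets M" "infinite_in M X"
  have "\<exists>c'. c' \<prec> numeral_in M k \<and> c = c'" if "\<tau> \<in> T" "entry_in M \<tau> x c" for \<tau> x c
    using *(1) that by (auto simp: tree_in_def strings_over_def)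
  then have "\<exists>H\<in>Sets M. H \<subseteq> X \<and> infinite_in M H \<and> infinite_in M {\<tau> \<in> T.
      \<exists>c'. c' \<prec> numeral_in M k \<and> (\<forall>x\<in>H. \<forall>c. entry_in M \<tau> x c \<longrightarrow> c = c')}"
    by (rule RWKL_recolour[where R = "(=)", OF assms * definable_equality])
  then obtain H where H: "H \<in> Sets M" "H \<subseteq> X" "infinite_in M H"
    "infinite_in M {\<tau> \<in> T. \<exists>c'. c' \<prec> numeral_in M k \<and> (\<forall>x\<in>H. \<forall>c. entry_in M \<tau> x c \<longrightarrow> c = c')}"
    by (elim bexE conjE)
  have "homogeneous_tree M k H T"
    unfolding homogeneous_tree_def
    by (rule infinite_in_mono[OF H(4)]) (use homogeneous_stringI in blast)
  then show "\<exists>H\<in>Sets M. H \<subseteq> X \<and> infinite_in M H \<and> homogeneous_tree M k H T"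
    using H by blast
qed

lemma LRWKL_imp_RWKL: assumes "LRWKL_k M k" shows "RWKL_k M k"
proof -
  have "definable (\<lambda>e. e 0 = e 0)" by (intro definability)
  from bounded_set[where P = "\<lambda>x. x = x", OF this] have "UNIV \<in> Sets M" by simp
  moreover have "infinite_in M UNIV"
    unfolding infinite_in_def using less_succ_iff ar.order_refl by blast
  ultimately show ?thesis
    using assms unfolding LRWKL_k_def RWKL_k_def by blast
qed

text \<open>
  The last colour \<open>k\<close> is separated from the others by a recolouring with two colours. If it does
  not win, the strings avoiding it on the homogeneous set \<open>G\<close> form an infinite tree, and the
  colours of its strings on \<open>G\<close> are below \<open>k\<close>, although elsewhere \<open>k\<close> may occur.
  This is why \<open>RWKL_recolour\<close> asks for new colours only at positions in the given infinite set.
\<close>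

lemma RWKL_imp_LRWKL_Suc: assumes "RWKL_k M 2" "RWKL_k M k" shows "LRWKL_k M (Suc k)"
  unfolding LRWKL_k_def
proof (intro allI ballI impI, elim conjE)
  fix T X
  assume *: "tree_in M (Suc k) T" "infinite_in M T" "X \<in> Sets M" "infinite_in M X"
  let ?k = "numeral_in M k"
  let ?R = "\<lambda>c c'. c = ?k \<longleftrightarrow> c' = \<one>"
  have two: "numeral_in M 2 = \<one> \<oplus> \<one>"
    by (simp only: numeral_2_eq_2 numeral_in.simps ar.add_0)
  have "\<one> \<prec> numeral_in M 2" "\<zero> \<prec> numeral_in M 2" "\<zero> \<noteq> \<one>"
    by (simp_all only: two less_succ_iff ar.order_refl zero_leq ar.zero_neq_one not_False_eq_True)
  then have "\<exists>c'. c' \<prec> numeral_in M 2 \<and> ?R c c'" for c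
    by (cases "c = ?k") blast+
  moreover have "definable (\<lambda>e. ?R (e 0) (e 1))" by (intro definability)
  ultimately have "\<exists>G\<in>Sets M. G \<subseteq> X \<and> infinite_in M G \<and> infinite_in M {\<tau> \<in> T.
      \<exists>c'. c' \<prec> numeral_in M 2 \<and> (\<forall>x\<in>G. \<forall>c. entry_in M \<tau> x c \<longrightarrow> ?R c c')}"
    by - (rule RWKL_recolour[where R = ?R, OF assms(1) *])
  then obtain G where G: "G \<in> Sets M" "G \<subseteq> X" "infinite_in M G"
    "infinite_in M {\<tau> \<in> T. \<exists>c'. c' \<prec> numeral_in M 2 \<and>
       (\<forall>x\<in>G. \<forall>c. entry_in M \<tau> x c \<longrightarrow> ?R c c')}"
    by (elim bexE conjE)
  define U where "U = {\<tau> \<in> T. \<forall>x\<in>G. \<forall>c. entry_in M \<tau> x c \<longrightarrow> c = ?k}"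
  define V where "V = {\<tau> \<in> T. \<forall>x\<in>G. \<forall>c. entry_in M \<tau> x c \<longrightarrow> c \<noteq> ?k}"
  have "infinite_in M (U \<union> V)"
  proof (rule infinite_in_mono[OF G(4)], intro subsetI)
    fix \<tau>
    assume "\<tau> \<in> {\<tau> \<in> T. \<exists>c'. c' \<prec> numeral_in M 2 \<and>
      (\<forall>x\<in>G. \<forall>c. entry_in M \<tau> x c \<longrightarrow> ?R c c')}"
    then obtain c' where "\<tau> \<in> T" "\<forall>x\<in>G. \<forall>c. entry_in M \<tau> x c \<longrightarrow> ?R c c'" by blast
    then show "\<tau> \<in> U \<union> V" by (cases "c' = \<one>") (simp_all add: U_def V_def)
  qed
  then consider "infinite_in M U" | "infinite_in M V" using infinite_in_Un by blast
  then show "\<exists>H\<in>Sets M. H \<subseteq> X \<and> infinite_in M H \<and> homogeneous_tree M (Suc k) H T"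
  proof cases
    case 1
    have "?k \<prec> numeral_in M (Suc k)" by (simp add: less_succ_iff)
    then have "U \<subseteq> {s \<in> T. homogeneous_string M (Suc k) G s}"
      unfolding U_def using homogeneous_stringI by blast
    then have "homogeneous_tree M (Suc k) G T"
      unfolding homogeneous_tree_def using 1 infinite_in_mono by blast
    then show ?thesis using G by blast
  next
    case 2
    have "\<tau> \<in> V \<longleftrightarrow> \<tau> \<in> T \<and> (\<forall>x. x \<preceq> \<tau> \<longrightarrow>
         (\<forall>c. c \<preceq> \<tau> \<longrightarrow> x \<in> G \<longrightarrow> entry_in M \<tau> x c \<longrightarrow> c \<noteq> ?k))" for \<tau>
      unfolding V_def using entry_in_leq entry_in_position_leq by blast
    moreover have "definable (\<lambda>e. e 0 \<in> T \<and> (\<forall>x. x \<preceq> e 0 \<longrightarrow> (\<forall>c. c \<preceq> e 0 \<longrightarrow> x \<in> G \<longrightarrow>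
        entry_in M (e 0) x c \<longrightarrow> c \<noteq> ?k)))"
      using *(1) by (intro definability definable_entry_in G) (auto simp: tree_in_def)
    ultimately have "definable (\<lambda>e. e 0 \<in> V)" by (simp only:)
    from bounded_set[where P = "\<lambda>\<tau>. \<tau> \<in> V", OF this] have "V \<in> Sets M" by simp
    moreover have "s \<in> V" if "t \<in> V" "is_string M s" "initial_segment M s t" for s t
      using that *(1) unfolding V_def tree_in_def initial_segment_def by blast
    ultimately have V: "tree_in M (Suc k) V"
      using *(1) unfolding tree_in_def V_def by blast
    have "\<exists>c'. c' \<prec> ?k \<and> c = c'" if "\<tau> \<in> V" "x \<in> G" "entry_in M \<tau> x c" for \<tau> x c
    proof -
      have "\<tau> \<in> strings_over M (Suc k)" using V that(1) by (auto simp: tree_in_def)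
      then have "c \<preceq> ?k" using that(3) by (auto simp: strings_over_def less_succ_iff)
      then show ?thesis using that unfolding V_def leq_def by blast
    qed
    then have "\<exists>H\<in>Sets M. H \<subseteq> G \<and> infinite_in M H \<and> infinite_in M {\<tau> \<in> V.
        \<exists>c'. c' \<prec> ?k \<and> (\<forall>x\<in>H. \<forall>c. entry_in M \<tau> x c \<longrightarrow> c = c')}"
      by (rule RWKL_recolour[where R = "(=)", OF assms(2) V 2 G(1,3) definable_equality])
    then obtain H where H: "H \<in> Sets M" "H \<subseteq> G" "infinite_in M H"
      "infinite_in M {\<tau> \<in> V. \<exists>c'. c' \<prec> ?k \<and> (\<forall>x\<in>H. \<forall>c. entry_in M \<tau> x c \<longrightarrow> c = c')}"
      by (elim bexE conjE)
    have "c' \<prec> numeral_in M (Suc k)" if "c' \<prec> ?k" for c'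
      using that by (simp add: less_succ_iff ar.less_imp_le)
    then have "{\<tau> \<in> V. \<exists>c'. c' \<prec> ?k \<and> (\<forall>x\<in>H. \<forall>c. entry_in M \<tau> x c \<longrightarrow> c = c')} \<subseteq>
        {s \<in> T. homogeneous_string M (Suc k) H s}"
      unfolding V_def using homogeneous_stringI by blast
    then have "homogeneous_tree M (Suc k) H T"
      unfolding homogeneous_tree_def by (rule infinite_in_mono[OF H(4)])
    then show ?thesis using H G(2) by blast
  qed
qed

lemma RWKL_two_imp_LRWKL: assumes "RWKL_k M 2" "2 \<le> k" shows "LRWKL_k M k"
  using assms(2)
proof (induction k rule: dec_induct)
  case base
  show ?case using assms(1) by (rule RWKL_imp_LRWKL)
next
  case (step k)
  then show ?case using assms(1) RWKL_imp_LRWKL_Suc LRWKL_imp_RWKL by blast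
qed

lemma numeral_in_mono: "m \<le> n \<Longrightarrow> numeral_in M m \<preceq> numeral_in M n"
  by (induction n rule: dec_induct) (auto intro: ar.order_trans)

text \<open>
  A string over \<open>l\<close> colours that is homogeneous with a colour \<open>c \<ge> l\<close> takes the colour
  \<open>c\<close> nowhere, so none of its positions lies in the homogeneous set and any colour below
  \<open>l\<close> works as well.
\<close>

lemma RWKL_fewer_colours: assumes "RWKL_k M k" "0 < l" "l \<le> k" shows "RWKL_k M l"
  unfolding RWKL_k_def
proof (intro allI impI, elim conjE)
  fix T assume T: "tree_in M l T" "infinite_in M T"
  have "strings_over M l \<subseteq> strings_over M k"
    using numeral_in_mono[OF assms(3)] ar.less_le_trans unfolding strings_over_def by blast
  then have "tree_in M k T" using T(1) unfolding tree_in_def by blast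
  then obtain H where H: "H \<in> Sets M" "infinite_in M H" "homogeneous_tree M k H T"
    using assms(1) T(2) unfolding RWKL_k_def by blast
  have "homogeneous_string M l H s" if s: "s \<in> T" "homogeneous_string M k H s" for s
  proof -
    obtain c where c: "\<And>i n. i \<in> H \<Longrightarrow> length_in M s n \<Longrightarrow> i \<prec> n \<Longrightarrow> entry_in M s i c"
      using s(2) unfolding homogeneous_string_def by blast
    show ?thesis
    proof (cases "c \<prec> numeral_in M l")
      case True
      then show ?thesis unfolding homogeneous_string_def using c by blast
    next
      case False
      then have "\<not> entry_in M s i c" for i
        using s(1) T(1) by (auto simp: tree_in_def strings_over_def)
      moreover have "\<zero> \<prec> numeral_in M l"
        using assms(2) by (cases l) (simp_all add: less_succ_iff)
      ultimately show ?thesis unfolding homogeneous_string_def using c by blast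
    qed
  qed
  then have "{s \<in> T. homogeneous_string M k H s} \<subseteq> {s \<in> T. homogeneous_string M l H s}"
    by blast
  then have "homogeneous_tree M l H T"
    using H(3) unfolding homogeneous_tree_def by - (rule infinite_in_mono)
  then show "\<exists>H\<in>Sets M. infinite_in M H \<and> homogeneous_tree M l H T"
    using H by blast
qed

end

theorem theorem3p27:
  fixes M :: "'a l2_structure" and k :: nat
  assumes "k \<ge> 2"
    and "RCA0_model M"
  shows "(RWKL M \<longleftrightarrow> LRWKL M) \<and>
         (LRWKL M \<longleftrightarrow> RWKL_k M k) \<and>
         (RWKL_k M k \<longleftrightarrow> LRWKL_k M k)"
proof -
  interpret rca0 M by (unfold_locales) (rule assms(2))
  have "RWKL_k M k \<Longrightarrow> RWKL_k M 2"
    using RWKL_fewer_colours[of k 2] assms(1) by simp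
  then show ?thesis
    unfolding RWKL_def LRWKL_def
    using RWKL_two_imp_LRWKL[OF _ assms(1)] RWKL_imp_LRWKL LRWKL_imp_RWKL by blast
qed

end
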